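(* Consider the sequence (in the sample size $n$) of instrumental variable models and the one-sided statistic $LM_1$ described in the context, with Assumption NA holding. Suppose $\Delta=\beta^*-\beta_0$ is fixed (not depending on $n$), $\pi\in\mathbb{R}^k$ is a fixed nonzero vector, and with $\mu=\mu_n=(Z'Z)^{1/2}\pi$ the impossibility design condition $$\mu'\Sigma_{11}^{-1}\Sigma_{21}\Sigma_{11}^{-1}\mu=0$$ holds (for every $n$). Let $$\gamma=\Sigma_{11}^{-1/2}(I_k-\Delta\Sigma_{21}\Sigma_{11}^{-1})D^{1/2}\pi,\qquad M_\gamma=I_k-\frac{\gamma\gamma'}{\|\gamma\|^2}.$$ Then, as $n\to\infty$, $$LM_1-\frac{\Delta\mu'\Sigma_{11}^{-1}\mu}{\left(\mu'\Sigma_{11}^{-1}\mu+\Delta^2\mu'\Sigma_{11}^{-1}\Sigma_{12}\Sigma_{11}^{-1}\Sigma_{21}\Sigma_{11}^{-1}\mu\right)^{1/2}}$$ converges in distribution to $$N\left(0,\;1+\|\gamma\|^{-2}\Delta^2\,\pi'D^{1/2}\Sigma_{11}^{-1/2}M_\gamma\Sigma_{11}^{-1/2}(\Sigma^{22})^{-1}\Sigma_{11}^{-1/2}M_\gamma\Sigma_{11}^{-1/2}D^{1/2}\pi\right).$$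
   Context: Model. For each $n$, $Z$ is a nonrandom $n\times k$ matrix of full column rank, and $Y=Z\pi a^{*\prime}+V$ with $a^*=(\beta^*,1)'$ and $V$ a random mean-zero $n\times2$ matrix of reduced-form errors (dependence on $n$ suppressed). Put $R=(Z'Z)^{-1/2}Z'Y=\mu a^{*\prime}+(Z'Z)^{-1/2}Z'V$ with $\mu=(Z'Z)^{1/2}\pi$. All matrix square roots are symmetric. Assumption NA: (a) $n^{-1}Z'Z\to D$, $D$ positive definite; (b) $n^{-1}V'V\to_p\Omega$, $\Omega$ positive definite; (c) $\mathrm{vec}((Z'Z)^{-1/2}Z'V)\to_d N(0,\Sigma)$ with $\Sigma\in\mathbb{R}^{2k\times2k}$ positive definite. $\Sigma$ is treated as known. Notation. $\beta_0\in\mathbb{R}$ is the fixed hypothesized value, $a_0=(\beta_0,1)'$, $b_0=(1,-\beta_0)'$, $B_0=\begin{pmatrix}1&0\\-\beta_0&1\end{pmatrix}$, $\Sigma_0=(B_0'\otimes I_k)\Sigma(B_0\otimes I_k)=\begin{pmatrix}\Sigma_{11}&\Sigma_{12}\\ \Sigma_{21}&\Sigma_{22}\end{pmatrix}$ ($k\times k$ blocks), $\Sigma^{22}=(\Sigma_{22}-\Sigma_{21}\Sigma_{11}^{-1}\Sigma_{12})^{-1}$. Statistics: $T=[(a_0'\otimes I_k)\Sigma^{-1}(a_0\otimes I_k)]^{-1/2}(a_0'\otimes I_k)\Sigma^{-1}\mathrm{vec}(R)$, $S=[(b_0'\otimes I_k)\Sigma(b_0\otimes I_k)]^{-1/2}(b_0'\otimes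 I_k)\mathrm{vec}(R)$, $$LM_1=\frac{S'\Sigma_{11}^{-1/2}(\Sigma^{22})^{-1/2}T}{\left\|\Sigma_{11}^{-1/2}(\Sigma^{22})^{-1/2}T\right\|}.$$ *)

theory Defs
  imports "HOL-Probability.Probability"
begin

section \<open>Matrices\<close>

definition pos_semidef :: "real^'n^'n \<Rightarrow> bool" where
  "pos_semidef A \<longleftrightarrow> transpose A = A \<and> (\<forall>x. x \<bullet> (A *v x) \<ge> 0)"

definition pos_def :: "real^'n^'n \<Rightarrow> bool" where
  "pos_def A \<longleftrightarrow> transpose A = A \<and> (\<forall>x. x \<noteq> 0 \<longrightarrow> x \<bullet> (A *v x) > 0)"

text \<open>The symmetric square root is the unique positive semidefinite one; it is only
  meaningful for positive semidefinite arguments.\<close>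

definition msqrt :: "real^'n^'n \<Rightarrow> real^'n^'n" where
  "msqrt A = (THE B. pos_semidef B \<and> B ** B = A)"

definition inv_msqrt :: "real^'n^'n \<Rightarrow> real^'n^'n" where
  "inv_msqrt A = matrix_inv (msqrt A)"

definition kron :: "real^'n^'m \<Rightarrow> real^'q^'p \<Rightarrow> real^('n \<times> 'q)^('m \<times> 'p)" where
  "kron A B = (\<chi> r c. A $ fst r $ fst c * B $ snd r $ snd c)"

text \<open>\<open>a' \<otimes> I\<^sub>k\<close> for a column vector \<open>a\<close>; its row index \<open>(1, i)\<close> is identified with \<open>i\<close>.
  Its transpose is \<open>a \<otimes> I\<^sub>k\<close>.\<close>

definition kron_row :: "real^'m \<Rightarrow> real^('m \<times> 'k)^'k" where
  "kron_row a = (\<chi> i. kron (rowvector a) (mat 1 :: real^'k^'k) $ (1 :: 1, i))"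

text \<open>Stacking of columns: the entry in row \<open>i\<close>, column \<open>j\<close> gets position \<open>(j, i)\<close>, which
  is the order matched by \<open>kron\<close>.\<close>

definition vec_cols :: "real^'m^'k \<Rightarrow> real^('m \<times> 'k)" where
  "vec_cols A = (\<chi> p. A $ snd p $ fst p)"

text \<open>Matrices whose number of rows is the sample size \<open>n\<close> are given by their rows
  \<open>X 0, \<dots>, X (n - 1)\<close>; the values of \<open>X\<close> from \<open>n\<close> on are irrelevant.
  \<open>cross n X W\<close> is the matrix product \<open>X' W\<close>.\<close>

definition cross :: "nat \<Rightarrow> (nat \<Rightarrow> real^'p) \<Rightarrow> (nat \<Rightarrow> real^'q) \<Rightarrow> real^'q^'p" where
  "cross n X W = (\<chi> a b. \<Sum>i<n. X i $ a * W i $ b)"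

text \<open>Linear independence of the columns: \<open>X c = 0\<close> only for \<open>c = 0\<close>.\<close>

definition full_column_rank :: "nat \<Rightarrow> (nat \<Rightarrow> real^'p) \<Rightarrow> bool" where
  "full_column_rank n X \<longleftrightarrow> (\<forall>c. (\<forall>i<n. X i \<bullet> c = 0) \<longrightarrow> c = 0)"


section \<open>Convergence in probability and in distribution\<close>

text \<open>The probability space may change along the sequence.\<close>

definition conv_in_prob ::
  "(nat \<Rightarrow> 'a measure) \<Rightarrow> (nat \<Rightarrow> 'a \<Rightarrow> 'b::metric_space) \<Rightarrow> 'b \<Rightarrow> bool" where
  "conv_in_prob M X c \<longleftrightarrow>
     (\<forall>\<epsilon>>0. (\<lambda>n. measure (M n) {\<omega> \<in> space (M n). dist (X n \<omega>) c > \<epsilon>}) \<longlonglongrightarrow> 0)"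

text \<open>Multivariate counterpart of \<open>weak_conv_m\<close>, which is available only on the real line.\<close>

definition conv_in_dist ::
  "(nat \<Rightarrow> 'a measure) \<Rightarrow> (nat \<Rightarrow> 'a \<Rightarrow> 'b::euclidean_space) \<Rightarrow> 'b measure \<Rightarrow> bool" where
  "conv_in_dist M X N \<longleftrightarrow>
     (\<forall>f :: 'b \<Rightarrow> real. continuous_on UNIV f \<and> bounded (range f) \<longrightarrow>
        (\<lambda>n. \<integral>\<omega>. f (X n \<omega>) \<partial>M n) \<longlonglongrightarrow> (\<integral>x. f x \<partial>N))"

text \<open>The law \<open>N(0, \<Sigma>)\<close> for positive definite \<open>\<Sigma>\<close>.\<close>

definition mvn :: "real^'n^'n \<Rightarrow> (real^'n) measure" where
  "mvn \<Sigma> = density lborel (\<lambda>x. ennreal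
     (exp (- (x \<bullet> (matrix_inv \<Sigma> *v x)) / 2) / sqrt ((2 * pi) ^ CARD('n) * det \<Sigma>)))"


section \<open>The instrumental variable model\<close>

text \<open>Rows of \<open>Y = Z \<pi> a*' + V\<close> with \<open>a* = (\<beta>, 1)'\<close>, where \<open>V\<close> is a random matrix of mean zero.\<close>

definition iv_model ::
  "nat \<Rightarrow> 'a measure \<Rightarrow> (nat \<Rightarrow> real^'k) \<Rightarrow> ('a \<Rightarrow> nat \<Rightarrow> real^2) \<Rightarrow> ('a \<Rightarrow> nat \<Rightarrow> real^2)
     \<Rightarrow> real^'k \<Rightarrow> real \<Rightarrow> bool" where
  "iv_model n M Z Y V \<pi> \<beta> \<longleftrightarrow>
     prob_space M \<and>
     full_column_rank n Z \<and>
     (\<forall>i<n. integrable M (\<lambda>\<omega>. V \<omega> i) \<and> (\<integral>\<omega>. V \<omega> i \<partial>M) = 0) \<and>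
     (\<forall>\<omega>\<in>space M. \<forall>i<n. Y \<omega> i = (Z i \<bullet> \<pi>) *\<^sub>R vector [\<beta>, 1] + V \<omega> i)"

definition assumption_NA ::
  "(nat \<Rightarrow> 'a measure) \<Rightarrow> (nat \<Rightarrow> nat \<Rightarrow> real^'k) \<Rightarrow> (nat \<Rightarrow> 'a \<Rightarrow> nat \<Rightarrow> real^2)
     \<Rightarrow> real^'k^'k \<Rightarrow> real^2^2 \<Rightarrow> real^(2 \<times> 'k::finite)^(2 \<times> 'k::finite) \<Rightarrow> bool" where
  "assumption_NA M Z V D \<Omega> \<Sigma> \<longleftrightarrow>
     ((\<lambda>n. (1 / real n) *\<^sub>R cross n (Z n) (Z n)) \<longlonglongrightarrow> D) \<and> pos_def D \<and>
     conv_in_prob M (\<lambda>n \<omega>. (1 / real n) *\<^sub>R cross n (V n \<omega>) (V n \<omega>)) \<Omega> \<and> pos_def \<Omega> \<and>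
     conv_in_dist M
       (\<lambda>n \<omega>. vec_cols (inv_msqrt (cross n (Z n) (Z n)) ** cross n (Z n) (V n \<omega>))) (mvn \<Sigma>) \<and>
     pos_def \<Sigma>"


section \<open>Statistics\<close>

definition R_stat :: "nat \<Rightarrow> (nat \<Rightarrow> real^'k) \<Rightarrow> (nat \<Rightarrow> real^2) \<Rightarrow> real^2^'k" where
  "R_stat n Z Y = inv_msqrt (cross n Z Z) ** cross n Z Y"

definition a_vec :: "real \<Rightarrow> real^2" where
  "a_vec \<beta>0 = vector [\<beta>0, 1]"

definition b_vec :: "real \<Rightarrow> real^2" where
  "b_vec \<beta>0 = vector [1, - \<beta>0]"

definition B_mat :: "real \<Rightarrow> real^2^2" where
  "B_mat \<beta>0 = vector [vector [1, 0], vector [- \<beta>0, 1]]"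

definition Sigma0 :: "real \<Rightarrow> real^(2 \<times> 'k::finite)^(2 \<times> 'k::finite) \<Rightarrow> real^(2 \<times> 'k::finite)^(2 \<times> 'k::finite)" where
  "Sigma0 \<beta>0 \<Sigma> =
     kron (transpose (B_mat \<beta>0)) (mat 1 :: real^'k^'k) ** \<Sigma> ** kron (B_mat \<beta>0) (mat 1 :: real^'k^'k)"

definition Sigma_block :: "2 \<Rightarrow> 2 \<Rightarrow> real \<Rightarrow> real^(2 \<times> 'k::finite)^(2 \<times> 'k::finite) \<Rightarrow> real^'k^'k" where
  "Sigma_block p q \<beta>0 \<Sigma> = (\<chi> i j. Sigma0 \<beta>0 \<Sigma> $ (p, i) $ (q, j))"

text \<open>\<open>\<Sigma>\<^sup>2\<^sup>2\<close>, with superscripts.\<close>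

definition Sigma_sup22 :: "real \<Rightarrow> real^(2 \<times> 'k::finite)^(2 \<times> 'k::finite) \<Rightarrow> real^'k^'k" where
  "Sigma_sup22 \<beta>0 \<Sigma> = matrix_inv (Sigma_block 2 2 \<beta>0 \<Sigma> -
     Sigma_block 2 1 \<beta>0 \<Sigma> ** matrix_inv (Sigma_block 1 1 \<beta>0 \<Sigma>) ** Sigma_block 1 2 \<beta>0 \<Sigma>)"

definition T_stat :: "real \<Rightarrow> real^(2 \<times> 'k::finite)^(2 \<times> 'k::finite) \<Rightarrow> real^2^'k \<Rightarrow> real^'k" where
  "T_stat \<beta>0 \<Sigma> R =
     (let A = kron_row (a_vec \<beta>0) in
      inv_msqrt (A ** matrix_inv \<Sigma> ** transpose A) *v (A *v (matrix_inv \<Sigma> *v vec_cols R)))"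

definition S_stat :: "real \<Rightarrow> real^(2 \<times> 'k::finite)^(2 \<times> 'k::finite) \<Rightarrow> real^2^'k \<Rightarrow> real^'k" where
  "S_stat \<beta>0 \<Sigma> R =
     (let B = kron_row (b_vec \<beta>0) in
      inv_msqrt (B ** \<Sigma> ** transpose B) *v (B *v vec_cols R))"

definition LM1 :: "real \<Rightarrow> real^(2 \<times> 'k::finite)^(2 \<times> 'k::finite) \<Rightarrow> real^2^'k \<Rightarrow> real" where
  "LM1 \<beta>0 \<Sigma> R =
     (let w = inv_msqrt (Sigma_block 1 1 \<beta>0 \<Sigma>) *v
                (inv_msqrt (Sigma_sup22 \<beta>0 \<Sigma>) *v T_stat \<beta>0 \<Sigma> R) in
      (S_stat \<beta>0 \<Sigma> R \<bullet> w) / norm w)"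

end

theory Submission
  imports Defs
begin

text \<open>Put \<open>J = \<Sigma>\<^sub>1\<^sub>1\<^sup>-\<^sup>1\<^sup>/\<^sup>2\<close>, \<open>h = J \<mu>\<close>, \<open>g = J (I - \<Delta> \<Sigma>\<^sub>2\<^sub>1 \<Sigma>\<^sub>1\<^sub>1\<^sup>-\<^sup>1) \<mu>\<close>. Then
  \<open>LM\<^sub>1 = (\<Delta> h + x)' (g + y) / \<parallel>g + y\<parallel>\<close>, where \<open>x\<close> and \<open>y\<close> are linear images of the normalized errors that
  become independent normal vectors in the limit. The design condition means \<open>h' g = h' h\<close> and removes the
  cross term of \<open>\<parallel>g\<parallel>\<^sup>2\<close>, so the centering constant is exactly \<open>\<Delta> h' g / \<parallel>g\<parallel>\<close>. As
  \<open>n\<^sup>-\<^sup>1\<^sup>/\<^sup>2 h \<rightarrow> h\<^sub>0\<close> and \<open>n\<^sup>-\<^sup>1\<^sup>/\<^sup>2 g \<rightarrow> \<gamma> \<noteq> 0\<close>, differentiating \<open>u \<mapsto> u / \<parallel>u\<parallel>\<close> at \<open>\<gamma>\<close> shows that the centered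
  statistic converges, locally uniformly in the errors, to the linear form
  \<open>x' \<gamma> / \<parallel>\<gamma>\<parallel> + \<Delta> h\<^sub>0' M\<^sub>\<gamma> y / \<parallel>\<gamma>\<parallel>\<close>. Its two summands are uncorrelated, which gives the variance.\<close>

section \<open>Square roots of positive definite matrices\<close>

lemma matrix_inv_unique:
  fixes A B :: "real^'n^'n"
  assumes "A ** B = mat 1"
  shows "matrix_inv A = B"
proof -
  have "B ** A = mat 1"
    using assms matrix_left_right_inverse by blast
  with assms have "\<exists>C. A ** C = mat 1 \<and> C ** A = mat 1"
    by blast
  then have inv: "A ** matrix_inv A = mat 1 \<and> matrix_inv A ** A = mat 1"
    unfolding matrix_inv_def by (rule someI_ex)
  have "matrix_inv A = matrix_inv A ** (A ** B)"
    by (simp only: assms matrix_mul_rid)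
  also have "\<dots> = B"
    by (simp only: matrix_mul_assoc inv matrix_mul_lid)
  finally show ?thesis .
qed

lemma inner_matrix_transpose: "x \<bullet> (A *v y) = (transpose A *v x) \<bullet> y" for A :: "real^'n^'m"
  using dot_lmul_matrix[of x A y] vector_transpose_matrix[of x "transpose A"] by simp

lemma matrix_diff_ldistrib: "A ** (B - C) = A ** B - A ** C" for A :: "'a::ring_1^'n^'m"
  by (vector matrix_matrix_mult_def sum_subtractf right_diff_distrib)

lemma matrix_diff_rdistrib: "(A - B) ** C = A ** C - B ** C" for A :: "'a::ring_1^'n^'m"
  by (vector matrix_matrix_mult_def sum_subtractf left_diff_distrib)

lemma pos_def_symmetric: "pos_def A \<Longrightarrow> transpose A = A"
  by (simp add: pos_def_def)

lemma pos_def_imp_pos_semidef: "pos_def A \<Longrightarrow> pos_semidef A"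
  unfolding pos_def_def pos_semidef_def
proof (intro conjI allI)
  fix x assume A: "transpose A = A \<and> (\<forall>x. x \<noteq> 0 \<longrightarrow> x \<bullet> (A *v x) > 0)"
  then show "transpose A = A" by simp
  show "x \<bullet> (A *v x) \<ge> 0" using A by (cases "x = 0") (auto intro: less_imp_le)
qed

lemma pos_def_inverse:
  fixes A :: "real^'n^'n"
  assumes "pos_def A"
  shows "A ** matrix_inv A = mat 1" "matrix_inv A ** A = mat 1"
proof -
  have "A *v x = 0 \<Longrightarrow> x = 0" for x
    using assms unfolding pos_def_def by force
  then obtain B where B: "B ** A = mat 1"
    using matrix_left_invertible_ker[of A] by blast
  then have "A ** B = mat 1" using matrix_left_right_inverse by blast
  with B show "A ** matrix_inv A = mat 1" "matrix_inv A ** A = mat 1"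
    using matrix_inv_unique by blast+
qed

lemma transpose_matrix_inv_pos_def:
  fixes A :: "real^'n^'n"
  assumes "pos_def A"
  shows "transpose (matrix_inv A) = matrix_inv A"
proof -
  have "transpose (matrix_inv A ** A) = mat 1"
    by (simp add: pos_def_inverse[OF assms])
  then have "A ** transpose (matrix_inv A) = mat 1"
    by (simp add: matrix_transpose_mul pos_def_symmetric[OF assms])
  from matrix_inv_unique[OF this] show ?thesis
    by simp
qed

text \<open>The constant is the minimum of the form on the unit sphere, attained by compactness and
  positive by definiteness; homogeneity of degree two gives the bound for all vectors.\<close>

lemma pos_def_coercive:
  fixes A :: "real^'n^'n"
  assumes "pos_def A"
  obtains l where "l > 0" "\<And>x. l * (norm x)\<^sup>2 \<le> x \<bullet> (A *v x)"
proof -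
  have "\<exists>a\<in>sphere (0::real^'n) 1. \<forall>x\<in>sphere 0 1. a \<bullet> (A *v a) \<le> x \<bullet> (A *v x)"
    by (intro continuous_attains_inf compact_sphere)
       (simp_all add: continuous_on_inner matrix_vector_mult_linear_continuous_on)
  then obtain a :: "real^'n" where a: "norm a = 1" "\<And>x. norm x = 1 \<Longrightarrow> a \<bullet> (A *v a) \<le> x \<bullet> (A *v x)"
    by auto
  show ?thesis
  proof
    show "a \<bullet> (A *v a) > 0"
      using assms a(1) unfolding pos_def_def by (cases "a = 0") auto
    show "a \<bullet> (A *v a) * (norm x)\<^sup>2 \<le> x \<bullet> (A *v x)" for x
    proof (cases "x = 0")
      case False
      have "a \<bullet> (A *v a) \<le> (x /\<^sub>R norm x) \<bullet> (A *v (x /\<^sub>R norm x))"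
        using False by (intro a(2)) simp
      then show ?thesis
        using False by (simp add: matrix_vector_mult_scaleR field_simps power2_eq_square)
    qed simp
  qed
qed

text \<open>With \<open>X = B - C\<close> one has \<open>B X + X C = B\<^sup>2 - C\<^sup>2\<close>; pairing this Sylvester equation with \<open>X\<close> in
  the Frobenius inner product gives uniqueness and continuity of square roots at once, without
  diagonalization.\<close>

lemma norm_diff_le_norm_square_diff:
  fixes B C :: "real^'n^'n"
  assumes B: "pos_semidef B" and C: "pos_semidef C"
    and l: "l > 0" "\<And>x. l * (norm x)\<^sup>2 \<le> x \<bullet> (C *v x)"
  shows "l * norm (B - C) \<le> norm (B ** B - C ** C)"
proof -
  define X where "X = B - C"
  have tX: "transpose X = X" and tB: "transpose B = B" and tC: "transpose C = C"
    using B C by (simp_all add: X_def pos_semidef_def transpose_def vec_eq_iff)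
  \<comment> \<open>For symmetric \<open>G\<close> the rows of \<open>X ** G\<close> are
    \<open>G\<close> applied to the rows of \<open>X\<close>, so \<open>X \<bullet> (X ** G)\<close>
    is a sum of quadratic forms of \<open>G\<close>.\<close>
  have row: "(X ** G) $ i = G *v X $ i" if "transpose G = G" for G i
    using that by (simp add: matrix_matrix_mult_def matrix_vector_mult_def vec_eq_iff transpose_def mult.commute)
  have inn: "transpose P \<bullet> transpose Q = P \<bullet> Q" for P Q :: "real^'n^'n"
    by (simp add: inner_vec_def transpose_def) (rule sum.swap)
  have "l * (norm X)\<^sup>2 = (\<Sum>i\<in>UNIV. l * (norm (X $ i))\<^sup>2)"
    by (simp add: sum_distrib_left[symmetric] power2_norm_eq_inner inner_vec_def[of X])
  also have "\<dots> \<le> (\<Sum>i\<in>UNIV. X $ i \<bullet> (B *v X $ i)) + (\<Sum>i\<in>UNIV. X $ i \<bullet> (C *v X $ i))"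
    using B l(2) by (intro add_increasing sum_nonneg sum_mono) (auto simp: pos_semidef_def)
  also have "\<dots> = X \<bullet> (X ** B) + X \<bullet> (X ** C)"
    by (simp add: inner_vec_def[of X] row tB tC)
  \<comment> \<open>Transposition preserves the Frobenius inner product and moves \<open>B\<close>
    to the left of \<open>X\<close>, producing \<open>B X + X C\<close>.\<close>
  also have "X \<bullet> (X ** B) = X \<bullet> (B ** X)"
    using inn[of X "B ** X"] by (simp add: matrix_transpose_mul tX tB)
  also have "X \<bullet> (B ** X) + X \<bullet> (X ** C) = X \<bullet> (B ** B - C ** C)"
    by (simp add: X_def matrix_diff_ldistrib matrix_diff_rdistrib flip: inner_add_right)
  also have "\<dots> \<le> norm X * norm (B ** B - C ** C)"
    by (rule norm_cauchy_schwarz)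
  finally have "norm X * (l * norm X) \<le> norm X * norm (B ** B - C ** C)"
    by (simp add: power2_eq_square mult_ac)
  then show ?thesis
    unfolding X_def[symmetric] by (cases "X = 0") auto
qed

text \<open>In terms of forms, \<open>A \<le> r\<close> yields \<open>A^2 \<le> r A\<close>;
  nonnegativity of the form at \<open>x - A x / r\<close> replaces the spectral theorem.\<close>

lemma pos_semidef_norm_square_le:
  fixes A :: "real^'n^'n"
  assumes A: "pos_semidef A" and r: "0 < r" "\<And>x. x \<bullet> (A *v x) \<le> r * (norm x)\<^sup>2"
  shows "(norm (A *v x))\<^sup>2 \<le> r * (x \<bullet> (A *v x))"
proof -
  have tA: "transpose A = A" using A by (simp add: pos_semidef_def)
  define y where "y = A *v x"
  define q where "q = y \<bullet> y"
  \<comment> \<open>This value minimizes \<open>- 2 t q + t^2 r q\<close>, the bound obtained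
    below.\<close>
  define t where "t = 1 / r"
  have xy: "x \<bullet> (A *v y) = q" by (simp only: inner_matrix_transpose tA y_def q_def)
  have "0 \<le> (x - t *\<^sub>R y) \<bullet> (A *v (x - t *\<^sub>R y))"
    using A by (simp add: pos_semidef_def)
  also have "\<dots> = x \<bullet> y - 2 * t * q + t\<^sup>2 * (y \<bullet> (A *v y))"
    using xy by (simp add: matrix_vector_mult_diff_distrib matrix_vector_mult_scaleR inner_diff_left
        inner_diff_right power2_eq_square right_diff_distrib flip: y_def q_def)
  also have "\<dots> \<le> x \<bullet> y - 2 * t * q + t\<^sup>2 * (r * q)"
    using r(2)[of y] by (intro add_mono mult_left_mono order_refl) (auto simp: q_def power2_norm_eq_inner)
  also have "\<dots> = x \<bullet> y - q / r"
    using r(1) by (simp add: t_def power2_eq_square)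
  finally show ?thesis
    using r(1) by (simp add: q_def y_def power2_norm_eq_inner field_simps)
qed

lemma pos_semidef_norm_le:
  fixes A :: "real^'n^'n"
  assumes A: "pos_semidef A" and r: "0 < r" "\<And>x. x \<bullet> (A *v x) \<le> r * (norm x)\<^sup>2"
  shows "norm (A *v x) \<le> r * norm x"
proof -
  have "(norm (A *v x))\<^sup>2 \<le> r * (r * (norm x)\<^sup>2)"
    using pos_semidef_norm_square_le[OF A r, of x] mult_left_mono[OF r(2)[of x], of r] r(1) by linarith
  also have "\<dots> = (r * norm x)\<^sup>2" by (simp add: power2_eq_square)
  finally show ?thesis by (rule power2_le_imp_le) (use r(1) in simp)
qed

lemma quadratic_form_bounded:
  fixes A :: "real^'n^'n"
  obtains r where "0 < r" "\<And>x. x \<bullet> (A *v x) \<le> r * (norm x)\<^sup>2"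
proof -
  obtain K where K: "0 < K" "\<And>x. norm (A *v x) \<le> norm x * K"
    using bounded_linear.pos_bounded[OF matrix_vector_mul_bounded_linear[of A]] by blast
  show ?thesis
  proof
    fix x
    have "x \<bullet> (A *v x) \<le> norm x * norm (A *v x)" by (rule norm_cauchy_schwarz)
    also have "\<dots> \<le> norm x * (norm x * K)" by (intro mult_left_mono K) simp
    finally show "x \<bullet> (A *v x) \<le> K * (norm x)\<^sup>2" by (simp add: power2_eq_square mult_ac)
  qed (rule K)
qed

lemma pos_semidef_inner_eq_0:
  fixes A :: "real^'n^'n"
  assumes A: "pos_semidef A" and "x \<bullet> (A *v x) = 0"
  shows "A *v x = 0"
proof -
  obtain r where "0 < r" "\<And>x. x \<bullet> (A *v x) \<le> r * (norm x)\<^sup>2"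
    using quadratic_form_bounded by blast
  from pos_semidef_norm_square_le[OF A this, of x] assms(2) show ?thesis by simp
qed

text \<open>\<open>B x = 0\<close> would force \<open>A x = 0\<close>, so \<open>B\<close> is
  injective, and a semidefinite form vanishes only on the kernel.\<close>

lemma pos_semidef_sqrt_pos_def:
  fixes A B :: "real^'n^'n"
  assumes A: "pos_def A" and B: "pos_semidef B" "B ** B = A"
  shows "pos_def B"
  unfolding pos_def_def
proof (intro conjI allI impI)
  show "transpose B = B" using B by (simp add: pos_semidef_def)
  fix x :: "real^'n" assume "x \<noteq> 0"
  have "B *v x \<noteq> 0"
  proof
    assume "B *v x = 0"
    then have "A *v x = 0"
      unfolding B(2)[symmetric] by (simp flip: matrix_vector_mul_assoc)
    then show False using A \<open>x \<noteq> 0\<close> unfolding pos_def_def by force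
  qed
  then show "x \<bullet> (B *v x) > 0"
    using B pos_semidef_inner_eq_0[OF B(1), of x] by (auto simp: pos_semidef_def order_less_le)
qed

text \<open>\<open>Y\<close> is the fixed point of \<open>Y \<mapsto> (X + Y^2) / 2\<close> on the
  closed set of self-adjoint operators of norm at most \<open>r\<close>. The set is invariant
  because \<open>(r + r^2) / 2 \<le> r\<close>, and the map has Lipschitz constant \<open>r\<close>
  there.\<close>

lemma sqrt_contraction_exists:
  fixes X :: "'a::{real_inner,banach} \<Rightarrow>\<^sub>L 'a"
  assumes r: "norm X \<le> r" "r < 1" and sym: "\<And>x y. X x \<bullet> y = x \<bullet> X y"
  obtains Y :: "'a \<Rightarrow>\<^sub>L 'a" where "norm Y \<le> r" "\<And>x y. Y x \<bullet> y = x \<bullet> Y y" "2 *\<^sub>R Y = X + (Y o\<^sub>L Y)"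
proof -
  define S where "S = {Y :: 'a \<Rightarrow>\<^sub>L 'a. norm Y \<le> r \<and> (\<forall>x y. blinfun_apply Y x \<bullet> y = x \<bullet> blinfun_apply Y y)}"
  define f where "f Y = (1/2 :: real) *\<^sub>R (X + (Y o\<^sub>L Y))" for Y
  have r0: "0 \<le> r" using r(1) norm_ge_zero order_trans by blast
  have "S = {Y. norm Y \<le> r} \<inter> (\<Inter>x. \<Inter>y. {Y. blinfun_apply Y x \<bullet> y = x \<bullet> blinfun_apply Y y})"
    by (auto simp: S_def)
  also have "closed \<dots>"
    by (intro closed_Int closed_INT ballI closed_Collect_le closed_Collect_eq continuous_intros)
  finally have S: "Topological_Spaces.complete S" by (simp add: complete_eq_closed)
  have "\<exists>!Y\<in>S. f Y = Y"
  proof (rule Banach_fix[OF S _ r0 r(2)])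
    show "S \<noteq> {}" using r sym by (auto simp: S_def)
    show "f ` S \<subseteq> S"
    proof (clarsimp simp: S_def)
      fix Y :: "'a \<Rightarrow>\<^sub>L 'a" assume Y: "norm Y \<le> r" "\<forall>x y. Y x \<bullet> y = x \<bullet> Y y"
      have "norm (X + (Y o\<^sub>L Y)) \<le> r + r * 1"
        using Y r r0 norm_blinfun_compose[of Y Y]
        by (intro norm_triangle_le add_mono order_trans[OF norm_blinfun_compose] mult_mono) auto
      then have "norm (f Y) \<le> r"
        by (simp add: f_def)
      then show "norm (f Y) \<le> r \<and> (\<forall>x y. f Y x \<bullet> y = x \<bullet> f Y y)"
        using Y(2) sym by (simp add: f_def blinfun.bilinear_simps inner_add_left inner_add_right)
    qed
    fix Y W assume "Y \<in> S" "W \<in> S"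
    then have n: "norm Y \<le> r" "norm W \<le> r" by (simp_all add: S_def)
    \<comment> \<open>The splitting \<open>Y^2 - W^2 = Y (Y - W) + (Y - W) W\<close> holds without
      commutativity.\<close>
    have "f Y - f W = (1/2) *\<^sub>R ((Y o\<^sub>L (Y - W)) + ((Y - W) o\<^sub>L W))"
      by (rule blinfun_eqI) (simp add: f_def blinfun.bilinear_simps algebra_simps)
    also have "norm \<dots> \<le> (1/2) * (r * norm (Y - W) + norm (Y - W) * r)"
      unfolding norm_scaleR using n r0
      by (intro mult_mono norm_triangle_le add_mono order_trans[OF norm_blinfun_compose]) auto
    finally show "dist (f Y) (f W) \<le> r * dist Y W"
      by (simp add: dist_norm mult_ac)
  qed
  then obtain Y where Y: "Y \<in> S" "f Y = Y" by blast
  have "2 *\<^sub>R f Y = X + (Y o\<^sub>L Y)" by (simp add: f_def)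
  with Y that show thesis by (auto simp: S_def)
qed

text \<open>If \<open>0 \<le> c A \<le> 1\<close>, then \<open>1 - Y\<close> is a square root of \<open>c A\<close> iff \<open>Y\<close> is a fixed point of
  \<open>Y \<mapsto> ((1 - c A) + Y\<^sup>2) / 2\<close>, a contraction in operator norm.\<close>

lemma pos_def_has_sqrt:
  fixes A :: "real^'n^'n"
  assumes A: "pos_def A"
  obtains B where "pos_semidef B" "B ** B = A"
proof -
  obtain l where l: "l > 0" "\<And>x. l * (norm x)\<^sup>2 \<le> x \<bullet> (A *v x)"
    using pos_def_coercive[OF A] by blast
  obtain u where u: "0 < u" "\<And>x. x \<bullet> (A *v x) \<le> u * (norm x)\<^sup>2"
    using quadratic_form_bounded by blast
  \<comment> \<open>This scaling gives \<open>c A \<le> 1\<close>, hence \<open>G \<ge> 0\<close>,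
    while coercivity keeps \<open>G\<close> below \<open>r = 1 - c l\<close>, which lies strictly
    between 0 and 1.\<close>
  define c where "c = 1 / (u + l)"
  define r where "r = 1 - c * l"
  have c: "0 < c" using l u by (simp add: c_def)
  have cl: "0 < c * l" "c * l < 1" using l u by (simp_all add: c_def)
  define G where "G = mat 1 - c *\<^sub>R A"
  have Gx: "G *v x = x - c *\<^sub>R (A *v x)" for x
    by (simp add: G_def matrix_vector_mult_diff_rdistrib scaleR_matrix_vector_assoc)
  have q: "x \<bullet> (G *v x) = (norm x)\<^sup>2 - c * (x \<bullet> (A *v x))" for x
    by (simp add: Gx inner_diff_right power2_norm_eq_inner)
  have tG: "transpose G = G"
    using pos_def_symmetric[OF A] by (simp add: G_def transpose_def vec_eq_iff mat_def)
  have "0 \<le> x \<bullet> (G *v x)" for x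
  proof -
    have "c * (x \<bullet> (A *v x)) \<le> c * (u * (norm x)\<^sup>2)"
      using c u by (intro mult_left_mono) auto
    also have "\<dots> \<le> 1 * (norm x)\<^sup>2"
      unfolding mult.assoc[symmetric] using l u by (intro mult_right_mono) (auto simp: c_def)
    finally show ?thesis by (simp add: q)
  qed
  then have psd: "pos_semidef G" using tG by (simp add: pos_semidef_def)
  have "x \<bullet> (G *v x) \<le> r * (norm x)\<^sup>2" for x
    using mult_left_mono[OF l(2)[of x], of c] c by (simp add: q r_def algebra_simps)
  then have Gn: "norm (G *v x) \<le> r * norm x" for x
    using cl by (intro pos_semidef_norm_le[OF psd]) (auto simp: r_def)
  \<comment> \<open>As a bounded operator \<open>G\<close> is measured in the operator norm, where
    it is at most \<open>r\<close>; the norm of the matrix type is the Frobenius norm.\<close>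
  define X where "X = Blinfun ((*v) G)"
  have X: "blinfun_apply X = (*v) G"
    unfolding X_def by (rule bounded_linear_Blinfun_apply) (rule matrix_vector_mul_bounded_linear)
  have "norm X \<le> r"
    using cl by (intro norm_blinfun_bound) (use Gn in \<open>auto simp: X r_def\<close>)
  moreover have "X x \<bullet> y = x \<bullet> X y" for x y
    unfolding X by (metis inner_matrix_transpose tG)
  ultimately obtain Y :: "(real^'n) \<Rightarrow>\<^sub>L (real^'n)" where Y: "norm Y \<le> r" "\<And>x y. Y x \<bullet> y = x \<bullet> Y y" "2 *\<^sub>R Y = X + (Y o\<^sub>L Y)"
    using sqrt_contraction_exists[of X r] cl by (auto simp: r_def)
  define B where "B = matrix (\<lambda>x. x - Y x)"
  have lin: "linear (\<lambda>x. x - Y x)"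
    by (auto intro!: linearI simp: blinfun.bilinear_simps algebra_simps)
  have Bx: "B *v x = x - Y x" for x
    unfolding B_def using fun_cong[OF matrix_vector_mul(2)[OF lin], of x] by simp
  have "B *v (B *v x) = (c *\<^sub>R A) *v x" for x
  proof -
    have "2 *\<^sub>R Y x = G *v x + Y (Y x)"
      using arg_cong[OF Y(3), of "\<lambda>Z. blinfun_apply Z x"] by (simp add: blinfun.bilinear_simps X)
    then show ?thesis
      by (simp add: Bx blinfun.bilinear_simps Gx algebra_simps scaleR_2 scaleR_matrix_vector_assoc)
  qed
  then have BB: "B ** B = c *\<^sub>R A"
    by (simp add: matrix_eq flip: matrix_vector_mul_assoc)
  have "(transpose B *v x) \<bullet> y = (B *v x) \<bullet> y" for x y
    by (simp only: inner_matrix_transpose[symmetric]) (simp add: Bx inner_diff_left inner_diff_right Y(2))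
  then have tB: "transpose B = B"
    by (metis matrix_eq vector_eq_rdot)
  have "x \<bullet> (B *v x) \<ge> 0" for x
  proof -
    have "x \<bullet> Y x \<le> norm x * norm (Y x)" by (rule norm_cauchy_schwarz)
    also have "\<dots> \<le> norm x * (1 * norm x)"
      using Y(1) cl by (intro mult_left_mono order_trans[OF norm_blinfun] mult_right_mono) (auto simp: r_def)
    finally show ?thesis by (simp add: Bx inner_diff_right dot_square_norm power2_eq_square)
  qed
  with tB have psdB: "pos_semidef B" by (simp add: pos_semidef_def)
  show thesis
  proof
    show "pos_semidef ((1 / sqrt c) *\<^sub>R B)"
      using psdB c by (simp add: pos_semidef_def transpose_scalar flip: scaleR_matrix_vector_assoc)
    show "((1 / sqrt c) *\<^sub>R B) ** ((1 / sqrt c) *\<^sub>R B) = A"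
      using c by (simp add: matrix_scalar_ac BB flip: scalar_matrix_assoc)
  qed
qed

text \<open>A semidefinite root of a definite matrix is definite, hence coercive, and the distance
  estimate applied to two roots with equal squares makes them agree. This gives the
  \<open>THE\<close> in \<open>msqrt\<close> its meaning.\<close>

lemma msqrt_unique:
  fixes A :: "real^'n^'n"
  assumes A: "pos_def A" and B: "pos_semidef B" "B ** B = A"
  shows "msqrt A = B"
  unfolding msqrt_def
proof (rule the_equality)
  fix C assume C: "pos_semidef C \<and> C ** C = A"
  obtain l where l: "l > 0" "\<And>x. l * (norm x)\<^sup>2 \<le> x \<bullet> (B *v x)"
    using pos_def_coercive[OF pos_semidef_sqrt_pos_def[OF A B]] by blast
  have "l * norm (C - B) \<le> norm (C ** C - B ** B)"
    using C B l by (intro norm_diff_le_norm_square_diff) auto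
  then have "norm (C - B) \<le> 0" using C B(2) l by (simp add: mult_le_0_iff)
  then show "C = B" by simp
qed (use B in simp)

lemma msqrt_pos_def:
  fixes A :: "real^'n^'n"
  assumes "pos_def A"
  shows "pos_def (msqrt A)" "msqrt A ** msqrt A = A"
proof -
  obtain B where B: "pos_semidef B" "B ** B = A" using pos_def_has_sqrt[OF assms] .
  have "msqrt A = B" by (rule msqrt_unique[OF assms B])
  then show "pos_def (msqrt A)" "msqrt A ** msqrt A = A"
    using B pos_semidef_sqrt_pos_def[OF assms B] by simp_all
qed

lemma msqrt_scaleR:
  fixes A :: "real^'n^'n"
  assumes A: "pos_def A" and c: "c > 0"
  shows "msqrt (c *\<^sub>R A) = sqrt c *\<^sub>R msqrt A"
proof (rule msqrt_unique)
  show "pos_def (c *\<^sub>R A)"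
    using A c by (simp add: pos_def_def transpose_scalar flip: scaleR_matrix_vector_assoc)
  show "pos_semidef (sqrt c *\<^sub>R msqrt A)"
    using pos_def_imp_pos_semidef[OF msqrt_pos_def(1)[OF A]] c
    by (simp add: pos_semidef_def transpose_scalar flip: scaleR_matrix_vector_assoc)
  show "(sqrt c *\<^sub>R msqrt A) ** (sqrt c *\<^sub>R msqrt A) = c *\<^sub>R A"
    using c by (simp add: matrix_scalar_ac msqrt_pos_def[OF A] flip: scalar_matrix_assoc)
qed

text \<open>The constant \<open>1 / l\<close> in the distance estimate comes from coercivity of
  \<open>msqrt D\<close> alone, so it is the same for all \<open>n\<close>.\<close>

lemma tendsto_msqrt:
  fixes A :: "'b \<Rightarrow> real^'n^'n"
  assumes lim: "(A \<longlongrightarrow> D) F" and D: "pos_def D" and A: "\<forall>\<^sub>F n in F. pos_def (A n)"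
  shows "((\<lambda>n. msqrt (A n)) \<longlongrightarrow> msqrt D) F"
proof -
  obtain l where l: "l > 0" "\<And>x. l * (norm x)\<^sup>2 \<le> x \<bullet> (msqrt D *v x)"
    using pos_def_coercive[OF msqrt_pos_def(1)[OF D]] by blast
  have "\<forall>\<^sub>F n in F. norm (msqrt (A n) - msqrt D) \<le> norm (A n - D) / l"
    using A
  proof eventually_elim
    case (elim n)
    have "l * norm (msqrt (A n) - msqrt D) \<le> norm (msqrt (A n) ** msqrt (A n) - msqrt D ** msqrt D)"
      using l by (intro norm_diff_le_norm_square_diff pos_def_imp_pos_semidef msqrt_pos_def elim D)
    then show ?case
      using l(1) by (simp add: msqrt_pos_def elim D field_simps)
  qed
  moreover have "((\<lambda>n. norm (A n - D) / l) \<longlongrightarrow> 0) F"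
    using lim by (auto intro!: tendsto_divide_zero tendsto_norm_zero LIM_zero)
  ultimately have "((\<lambda>n. msqrt (A n) - msqrt D) \<longlongrightarrow> 0) F"
    by (rule Lim_null_comparison)
  then show ?thesis by (rule LIM_zero_cancel)
qed

lemma inv_msqrt_pos_def:
  fixes A :: "real^'n^'n"
  assumes "pos_def A"
  shows "transpose (inv_msqrt A) = inv_msqrt A" "inv_msqrt A ** msqrt A = mat 1"
    "msqrt A ** inv_msqrt A = mat 1" "inv_msqrt A ** A = msqrt A" "inv_msqrt A ** inv_msqrt A = matrix_inv A"
proof -
  note P = msqrt_pos_def[OF assms]
  show "transpose (inv_msqrt A) = inv_msqrt A"
    unfolding inv_msqrt_def by (rule transpose_matrix_inv_pos_def[OF P(1)])
  show 1: "inv_msqrt A ** msqrt A = mat 1" and 2: "msqrt A ** inv_msqrt A = mat 1"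
    using pos_def_inverse[OF P(1)] by (simp_all add: inv_msqrt_def)
  show 3: "inv_msqrt A ** A = msqrt A"
    using arg_cong[OF P(2), of "\<lambda>B. inv_msqrt A ** B"] by (simp add: matrix_mul_assoc 1)
  have "A ** (inv_msqrt A ** inv_msqrt A) = msqrt A ** (msqrt A ** inv_msqrt A) ** inv_msqrt A"
    by (simp only: matrix_mul_assoc P(2))
  then show "inv_msqrt A ** inv_msqrt A = matrix_inv A"
    using matrix_inv_unique[of A "inv_msqrt A ** inv_msqrt A"] by (simp add: 2)
qed

section \<open>Linear forms of a multivariate normal law\<close>

text \<open>Testing with the constant 1 passes total mass to the limit. For
  \<open>mvn \<Sigma>\<close> this supplies the normalization of the density without computing a
  Gaussian integral.\<close>

lemma prob_space_conv_in_dist_limit: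
  assumes conv: "conv_in_dist M X N" and M: "\<forall>\<^sub>F n in sequentially. prob_space (M n)"
  shows "prob_space N"
proof
  have "(\<lambda>n. \<integral>\<omega>. 1 \<partial>M n) \<longlonglongrightarrow> (\<integral>x. (1::real) \<partial>N)"
    using conv unfolding conv_in_dist_def by (auto elim!: allE[of _ "\<lambda>_. 1"])
  moreover have "\<forall>\<^sub>F n in sequentially. (\<integral>\<omega>. 1 \<partial>M n) = (1::real)"
    using M by eventually_elim (simp add: prob_space.prob_space)
  ultimately have "(\<lambda>n. 1) \<longlonglongrightarrow> (\<integral>x. (1::real) \<partial>N)"
    using tendsto_cong by fast
  then have "measure N (space N) = 1"
    by (simp add: LIMSEQ_const_iff)
  \<comment> \<open>\<open>measure\<close> returns 0 for infinite mass, so the value 1 rules that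
    case out.\<close>
  then show "emeasure N (space N) = 1"
    by (cases "emeasure N (space N)") (auto simp: measure_def)
qed

lemma nn_integral_lborel_translate:
  fixes f :: "'a::euclidean_space \<Rightarrow> ennreal"
  assumes [measurable]: "f \<in> borel_measurable borel"
  shows "(\<integral>\<^sup>+x. f x \<partial>lborel) = (\<integral>\<^sup>+x. f (a + x) \<partial>lborel)"
  by (subst lborel_distr_plus[of a, symmetric]) (simp add: nn_integral_distr)

text \<open>Spreading the integral over the translates of the density along \<open>\<Sigma> c\<close> makes the integrand
  factor into a function of \<open>c \<bullet> x\<close> after translation and a remainder, so the law of \<open>c \<bullet> x\<close> is
  found without changing variables by \<open>\<Sigma>\<^sup>1\<^sup>/\<^sup>2\<close> and without evaluating the normalizing constant.\<close>

lemma distr_mvn_inner: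
  fixes \<Sigma> :: "real^'n^'n"
  assumes \<Sigma>: "pos_def \<Sigma>" and "prob_space (mvn \<Sigma>)" and c: "c \<bullet> (\<Sigma> *v c) > 0"
  shows "distr (mvn \<Sigma>) borel (\<lambda>x. c \<bullet> x) = density lborel (normal_density 0 (sqrt (c \<bullet> (\<Sigma> *v c))))"
proof -
  \<comment> \<open>Since \<open>P v = c\<close>, a translation along \<open>v\<close> changes the
    Gaussian exponent only through \<open>c \<bullet> x\<close>.\<close>
  define v where "v = \<Sigma> *v c"
  define s2 where "s2 = c \<bullet> v"
  define P where "P = matrix_inv \<Sigma>"
  define p where "p x = ennreal (exp (- (x \<bullet> (P *v x)) / 2) / sqrt ((2 * pi) ^ CARD('n) * det \<Sigma>))" for x :: "real^'n"
  have s2: "s2 > 0" using c by (simp add: s2_def v_def)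
  have mvn: "mvn \<Sigma> = density lborel p" by (simp add: mvn_def p_def[abs_def] P_def)
  have [measurable]: "(\<lambda>x. P *v x) \<in> borel_measurable borel"
    by (intro borel_measurable_continuous_onI matrix_vector_mult_linear_continuous_on)
  have [measurable]: "p \<in> borel_measurable borel"
    unfolding p_def by measurable
  have Pv: "P *v v = c"
    by (simp add: v_def P_def matrix_vector_mul_assoc pos_def_inverse[OF \<Sigma>])
  have tP: "transpose P = P" by (simp add: P_def transpose_matrix_inv_pos_def[OF \<Sigma>])
  have vP: "v \<bullet> (P *v x) = c \<bullet> x" for x
    by (simp only: inner_matrix_transpose tP Pv)
  have shift: "p (s *\<^sub>R v + x) = p x * ennreal (exp (- s * (c \<bullet> x) - s\<^sup>2 * s2 / 2))" for s x
  proof -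
    have "(s *\<^sub>R v + x) \<bullet> (P *v (s *\<^sub>R v + x)) = x \<bullet> (P *v x) + 2 * s * (c \<bullet> x) + s\<^sup>2 * s2"
      by (simp add: matrix_vector_right_distrib matrix_vector_mult_scaleR inner_add_left inner_add_right
          vP Pv s2_def power2_eq_square inner_commute[of x c] inner_commute[of v c] algebra_simps)
    then have "exp (- ((s *\<^sub>R v + x) \<bullet> (P *v (s *\<^sub>R v + x))) / 2)
        = exp (- (x \<bullet> (P *v x)) / 2) * exp (- s * (c \<bullet> x) - s\<^sup>2 * s2 / 2)"
      by (simp add: diff_divide_distrib add_divide_distrib flip: exp_add)
    then show ?thesis
      unfolding p_def by (subst ennreal_mult''[symmetric]) auto
  qed
  \<comment> \<open>Any measurable nonnegative weight of total integral one would serve for the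
    averaging below.\<close>
  define \<phi> :: "real \<Rightarrow> ennreal" where "\<phi> = indicator {0..1}"
  have [measurable]: "\<phi> \<in> borel_measurable borel" by (simp add: \<phi>_def)
  \<comment> \<open>The remainder of the factorization; it does not depend on the test function
    \<open>g\<close>.\<close>
  define C where "C = (\<integral>\<^sup>+x. p x * \<phi> (c \<bullet> x) * ennreal (sqrt (2 * pi * s2) * exp ((c \<bullet> x)\<^sup>2 / (2 * s2))) \<partial>lborel)"
  have key: "(\<integral>\<^sup>+x. g (c \<bullet> x) * p x \<partial>lborel) = (\<integral>\<^sup>+r. g r * normal_density 0 (sqrt s2) r \<partial>lborel) * C"
    if [measurable]: "g \<in> borel_measurable borel" for g :: "real \<Rightarrow> ennreal"
  proof -
    have one: "(\<integral>\<^sup>+s. s2 * \<phi> (u - s * s2) \<partial>lborel) = 1" for u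
    proof -
      have "1 = (\<integral>\<^sup>+s. \<phi> s \<partial>lborel)" by (simp add: \<phi>_def)
      also have "\<dots> = ennreal \<bar>- s2\<bar> * (\<integral>\<^sup>+s. \<phi> (u + (- s2) * s) \<partial>lborel)"
        using s2 by (intro nn_integral_real_affine) auto
      also have "\<dots> = (\<integral>\<^sup>+s. s2 * \<phi> (u - s * s2) \<partial>lborel)"
        using s2 by (subst nn_integral_cmult[symmetric]) (auto simp: mult.commute)
      finally show ?thesis ..
    qed
    \<comment> \<open>Under \<open>r = u + s * s2\<close> the exponent becomes
      \<open>(u^2 - r^2) / (2 * s2)\<close>, so averaging over translations gives the normal
      integral of \<open>g\<close> times a factor in \<open>u\<close> alone.\<close>
    have inner: "(\<integral>\<^sup>+s. s2 * (g (u + s * s2) * ennreal (exp (- s * u - s\<^sup>2 * s2 / 2))) \<partial>lborel)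
       = ennreal (sqrt (2 * pi * s2) * exp (u\<^sup>2 / (2 * s2))) * (\<integral>\<^sup>+r. g r * normal_density 0 (sqrt s2) r \<partial>lborel)" for u
    proof -
      have "ennreal (sqrt (2 * pi * s2) * exp (u\<^sup>2 / (2 * s2))) * (\<integral>\<^sup>+r. g r * normal_density 0 (sqrt s2) r \<partial>lborel)
          = (\<integral>\<^sup>+r. g r * ennreal (exp (- (r\<^sup>2 - u\<^sup>2) / (2 * s2))) \<partial>lborel)"
        using s2 by (subst nn_integral_cmult[symmetric])
          (auto intro!: nn_integral_cong simp: normal_density_def mult.left_commute[of _ "g _"] diff_divide_distrib
            simp flip: ennreal_mult' exp_add exp_diff)
      also have "\<dots> = ennreal \<bar>s2\<bar> * (\<integral>\<^sup>+s. g (u + s2 * s) * ennreal (exp (- ((u + s2 * s)\<^sup>2 - u\<^sup>2) / (2 * s2))) \<partial>lborel)"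
        using s2 by (intro nn_integral_real_affine) auto
      also have "\<dots> = ennreal \<bar>s2\<bar> * (\<integral>\<^sup>+s. g (u + s * s2) * ennreal (exp (- s * u - s\<^sup>2 * s2 / 2)) \<partial>lborel)"
      proof -
        have "- ((u + s2 * s)\<^sup>2 - u\<^sup>2) / (2 * s2) = - s * u - s\<^sup>2 * s2 / 2" for s
          using s2 by (simp add: field_simps power2_eq_square)
        then show ?thesis by (simp add: mult.commute)
      qed
      also have "\<dots> = (\<integral>\<^sup>+s. s2 * (g (u + s * s2) * ennreal (exp (- s * u - s\<^sup>2 * s2 / 2))) \<partial>lborel)"
        using s2 by (subst nn_integral_cmult[symmetric]) auto
      finally show ?thesis ..
    qed
    have "(\<integral>\<^sup>+x. g (c \<bullet> x) * p x \<partial>lborel) = (\<integral>\<^sup>+x. g (c \<bullet> x) * p x * (\<integral>\<^sup>+s. s2 * \<phi> (c \<bullet> x - s * s2) \<partial>lborel) \<partial>lborel)"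
      by (simp add: one)
    also have "\<dots> = (\<integral>\<^sup>+x. \<integral>\<^sup>+s. g (c \<bullet> x) * p x * (s2 * \<phi> (c \<bullet> x - s * s2)) \<partial>lborel \<partial>lborel)"
      by (subst nn_integral_cmult) auto
    also have "\<dots> = (\<integral>\<^sup>+s. \<integral>\<^sup>+x. g (c \<bullet> x) * p x * (s2 * \<phi> (c \<bullet> x - s * s2)) \<partial>lborel \<partial>lborel)"
      by (rule lborel_pair.Fubini'[symmetric]) measurable
    \<comment> \<open>After translation by \<open>s v\<close> the weight is
      \<open>\<phi> (c \<bullet> x)\<close>, free of \<open>s\<close>, because
      \<open>c \<bullet> v = s2\<close>.\<close>
    also have "\<dots> = (\<integral>\<^sup>+s. \<integral>\<^sup>+x. g (c \<bullet> (s *\<^sub>R v + x)) * p (s *\<^sub>R v + x) * (s2 * \<phi> (c \<bullet> (s *\<^sub>R v + x) - s * s2)) \<partial>lborel \<partial>lborel)"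
      by (intro nn_integral_cong nn_integral_lborel_translate) measurable
    also have "\<dots> = (\<integral>\<^sup>+s. \<integral>\<^sup>+x. p x * \<phi> (c \<bullet> x) * (s2 * (g (c \<bullet> x + s * s2) * ennreal (exp (- s * (c \<bullet> x) - s\<^sup>2 * s2 / 2)))) \<partial>lborel \<partial>lborel)"
      by (intro nn_integral_cong) (simp add: shift inner_add_right flip: s2_def, simp add: mult_ac add.commute)
    also have "\<dots> = (\<integral>\<^sup>+x. \<integral>\<^sup>+s. p x * \<phi> (c \<bullet> x) * (s2 * (g (c \<bullet> x + s * s2) * ennreal (exp (- s * (c \<bullet> x) - s\<^sup>2 * s2 / 2)))) \<partial>lborel \<partial>lborel)"
      by (rule lborel_pair.Fubini') measurable
    also have "\<dots> = (\<integral>\<^sup>+x. p x * \<phi> (c \<bullet> x) * (\<integral>\<^sup>+s. s2 * (g (c \<bullet> x + s * s2) * ennreal (exp (- s * (c \<bullet> x) - s\<^sup>2 * s2 / 2))) \<partial>lborel) \<partial>lborel)"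
      by (subst nn_integral_cmult) auto
    also have "\<dots> = (\<integral>\<^sup>+x. (\<integral>\<^sup>+r. g r * normal_density 0 (sqrt s2) r \<partial>lborel)
        * (p x * \<phi> (c \<bullet> x) * ennreal (sqrt (2 * pi * s2) * exp ((c \<bullet> x)\<^sup>2 / (2 * s2)))) \<partial>lborel)"
      unfolding inner by (simp add: mult_ac)
    also have "\<dots> = (\<integral>\<^sup>+r. g r * normal_density 0 (sqrt s2) r \<partial>lborel) * C"
      unfolding C_def by (rule nn_integral_cmult) measurable
    finally show ?thesis .
  qed
  interpret nd: prob_space "density lborel (normal_density 0 (sqrt s2))"
    using s2 by (intro prob_space_normal_density) auto
  have "(\<integral>\<^sup>+x. 1 * p x \<partial>lborel) = 1"
    using prob_space.emeasure_space_1[OF assms(2)] unfolding mvn by (simp add: emeasure_density)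
  moreover have "(\<integral>\<^sup>+r. 1 * normal_density 0 (sqrt s2) r \<partial>lborel) = 1"
    using nd.emeasure_space_1 by (simp add: emeasure_density)
  \<comment> \<open>For \<open>g = 1\<close> both integrals are total masses of probability
    laws.\<close>
  ultimately have C: "C = 1" using key[of "\<lambda>_. 1"] by simp
  show ?thesis
  proof (rule measure_eqI)
    fix B assume "B \<in> sets (distr (mvn \<Sigma>) borel (\<lambda>x. c \<bullet> x))"
    then have [measurable]: "B \<in> sets borel" by simp
    have [measurable]: "(\<lambda>x. c \<bullet> x) -` B \<in> sets borel"
      by (rule measurable_sets_borel[OF _ \<open>B \<in> sets borel\<close>]) measurable
    have "emeasure (distr (mvn \<Sigma>) borel (\<lambda>x. c \<bullet> x)) B = (\<integral>\<^sup>+x. indicator B (c \<bullet> x) * p x \<partial>lborel)"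
      by (subst emeasure_distr)
        (auto simp: mvn emeasure_density mult.commute[of "p _"] intro!: nn_integral_cong split: split_indicator)
    also have "\<dots> = emeasure (density lborel (normal_density 0 (sqrt s2))) B"
      by (subst key) (auto simp: C emeasure_density mult.commute)
    finally show "emeasure (distr (mvn \<Sigma>) borel (\<lambda>x. c \<bullet> x)) B
        = emeasure (density lborel (normal_density 0 (sqrt (c \<bullet> (\<Sigma> *v c))))) B"
      by (simp add: s2_def v_def)
  qed simp
qed

section \<open>Convergence in distribution under varying maps\<close>

text \<open>The indicator of a tail is not continuous, so a continuous ramp above it is tested
  instead; dominated convergence makes the ramp's integral under \<open>N\<close> small.\<close>

lemma conv_in_dist_tight:
  fixes X :: "nat \<Rightarrow> 'a \<Rightarrow> 'b::euclidean_space"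
  assumes conv: "conv_in_dist M X N" and "prob_space N" and sets_N: "sets N = sets borel"
    and M: "\<forall>\<^sub>F n in sequentially. prob_space (M n) \<and> X n \<in> borel_measurable (M n)"
    and e: "0 < e"
  obtains K where "\<forall>\<^sub>F n in sequentially. measure (M n) {\<omega> \<in> space (M n). norm (X n \<omega>) > K} < e"
proof -
  interpret N: prob_space N by fact
  define b :: "nat \<Rightarrow> 'b \<Rightarrow> real" where "b k x = min 1 (max 0 (norm x - real k))" for k x
  have cont: "continuous_on UNIV (b k)" for k
    unfolding b_def by (intro continuous_intros)
  have bound: "0 \<le> b k x" "b k x \<le> 1" for k and x :: 'b by (auto simp: b_def)
  have bm: "b k \<in> borel_measurable borel" for k
    using cont by (rule borel_measurable_continuous_onI)
  have [measurable]: "b k \<in> borel_measurable N" for k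
    using bm unfolding measurable_cong_sets[OF sets_N refl] .
  have "(\<lambda>k. \<integral>x. b k x \<partial>N) \<longlonglongrightarrow> (\<integral>x. 0 \<partial>N)"
  proof (rule integral_dominated_convergence[where w="\<lambda>_. 1"])
    show "AE x in N. (\<lambda>k. b k x) \<longlonglongrightarrow> 0"
    proof (rule AE_I2)
      fix x :: 'b
      obtain k0 where "norm x < real k0" using reals_Archimedean2 by blast
      then have "\<forall>\<^sub>F k in sequentially. b k x = 0"
        by (intro eventually_sequentiallyI[of k0]) (auto simp: b_def)
      then show "(\<lambda>k. b k x) \<longlonglongrightarrow> 0" by (rule tendsto_eventually)
    qed
    show "AE x in N. norm (b k x) \<le> 1" for k using bound by simp
  qed auto
  then have "\<forall>\<^sub>F k in sequentially. (\<integral>x. b k x \<partial>N) < e"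
    using e by (intro order_tendstoD(2)) auto
  then obtain k where k: "(\<integral>x. b k x \<partial>N) < e"
    by (auto simp: eventually_sequentially)
  have "bounded (range (b k))"
    using bound by (intro boundedI[of _ 1]) auto
  then have "(\<lambda>n. \<integral>\<omega>. b k (X n \<omega>) \<partial>M n) \<longlonglongrightarrow> (\<integral>x. b k x \<partial>N)"
    using conv cont unfolding conv_in_dist_def by blast
  then have "\<forall>\<^sub>F n in sequentially. (\<integral>\<omega>. b k (X n \<omega>) \<partial>M n) < e"
    using k by (rule order_tendstoD(2))
  \<comment> \<open>The ramp \<open>b k\<close> reaches 1 at norm \<open>k + 1\<close>, whence this
    radius.\<close>
  then have "\<forall>\<^sub>F n in sequentially. measure (M n) {\<omega> \<in> space (M n). norm (X n \<omega>) > real k + 1} < e"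
    using M
  proof eventually_elim
    case (elim n)
    then interpret prob_space "M n" by simp
    have [measurable]: "X n \<in> borel_measurable (M n)" using elim by simp
    note [measurable] = bm
    have "measure (M n) {\<omega> \<in> space (M n). norm (X n \<omega>) > real k + 1}
        = (\<integral>\<omega>. indicator {\<omega> \<in> space (M n). norm (X n \<omega>) > real k + 1} \<omega> \<partial>M n)"
      by simp
    also have "\<dots> \<le> (\<integral>\<omega>. b k (X n \<omega>) \<partial>M n)"
    proof (rule integral_mono)
      show "integrable (M n) (\<lambda>\<omega>. b k (X n \<omega>))"
        using bound by (intro integrable_const_bound[of _ 1]) auto
      show "integrable (M n) (indicat_real {\<omega> \<in> space (M n). norm (X n \<omega>) > real k + 1})"
        by (intro integrable_const_bound[of _ 1]) auto
    qed (auto simp: b_def split: split_indicator)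
    finally show ?case using elim by simp
  qed
  then show thesis by (rule that)
qed

text \<open>A limit along the product filter controls \<open>F n\<close> on a whole neighbourhood of
  each point for all large \<open>n\<close>; finitely many such neighbourhoods cover
  \<open>C\<close>.\<close>

lemma uniform_on_compact_of_prod_filter:
  fixes F :: "nat \<Rightarrow> 'b::metric_space \<Rightarrow> real"
  assumes lim: "\<And>x. ((\<lambda>(n, y). F n y) \<longlongrightarrow> l x) (sequentially \<times>\<^sub>F nhds x)"
    and l: "continuous_on UNIV l" and C: "compact C" and e: "0 < e"
  shows "\<forall>\<^sub>F n in sequentially. \<forall>x\<in>C. \<bar>F n x - l x\<bar> < e"
proof -
  have "\<exists>U. open U \<and> x \<in> U \<and> (\<forall>\<^sub>F n in sequentially. \<forall>y\<in>U. \<bar>F n y - l y\<bar> < e)" for x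
  proof -
    have "\<forall>\<^sub>F (n, y) in sequentially \<times>\<^sub>F nhds x. dist (F n y) (l x) < e / 2"
      using tendstoD[OF lim, of "e / 2" x] e by (simp add: case_prod_unfold)
    then obtain P Q where P: "eventually P sequentially" and Q: "eventually Q (nhds x)"
      and PQ: "\<And>n y. P n \<Longrightarrow> Q y \<Longrightarrow> dist (F n y) (l x) < e / 2"
      unfolding eventually_prod_filter by auto
    have "isCont l x" using l by (simp add: continuous_on_eq_continuous_at)
    then have "(l \<longlongrightarrow> l x) (nhds x)"
      by (simp add: continuous_at tendsto_nhds_iff)
    then have "\<forall>\<^sub>F y in nhds x. dist (l y) (l x) < e / 2"
      using e by (intro tendstoD) auto
    with Q have "\<forall>\<^sub>F y in nhds x. Q y \<and> dist (l y) (l x) < e / 2"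
      by (rule eventually_conj)
    then obtain U where U: "open U" "x \<in> U" "\<And>y. y \<in> U \<Longrightarrow> Q y \<and> dist (l y) (l x) < e / 2"
      unfolding eventually_nhds by blast
    have "\<forall>\<^sub>F n in sequentially. \<forall>y\<in>U. \<bar>F n y - l y\<bar> < e"
      using P
    proof eventually_elim
      case (elim n)
      show ?case
      proof
        fix y assume "y \<in> U"
        then show "\<bar>F n y - l y\<bar> < e"
          using PQ[OF elim, of y] U(3)[of y] unfolding dist_real_def by linarith
      qed
    qed
    with U show ?thesis by blast
  qed
  then have "\<forall>x. \<exists>U. open U \<and> x \<in> U \<and> (\<forall>\<^sub>F n in sequentially. \<forall>y\<in>U. \<bar>F n y - l y\<bar> < e)"
    by blast
  from choice[OF this] obtain U where U: "\<And>x. open (U x)" "\<And>x. x \<in> U x"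
    "\<And>x. \<forall>\<^sub>F n in sequentially. \<forall>y\<in>U x. \<bar>F n y - l y\<bar> < e"
    by blast
  obtain T where T: "T \<subseteq> C" "finite T" "C \<subseteq> (\<Union>x\<in>T. U x)"
    by (rule compactE_image[OF C, of C U]) (use U(1,2) in auto)
  have "\<forall>\<^sub>F n in sequentially. \<forall>x\<in>T. \<forall>y\<in>U x. \<bar>F n y - l y\<bar> < e"
    using T(2) U(3) by (simp add: eventually_ball_finite)
  then show ?thesis
    by eventually_elim (use T(3) in blast)
qed

text \<open>\<open>G n\<close> is first replaced by \<open>g\<close> under the law of
  \<open>X n\<close>. Inside a large ball convergence is uniform; outside it, tightness and the
  bound \<open>2 * B\<close> on the difference apply.\<close>

lemma conv_in_dist_integral_of_seq:
  fixes X :: "nat \<Rightarrow> 'a \<Rightarrow> 'b::euclidean_space" and G :: "nat \<Rightarrow> 'b \<Rightarrow> real"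
  assumes conv: "conv_in_dist M X N" and N: "prob_space N" "sets N = sets borel"
    and M: "\<forall>\<^sub>F n in sequentially. prob_space (M n) \<and> X n \<in> borel_measurable (M n)"
    and lim: "\<And>x. ((\<lambda>(n, y). G n y) \<longlongrightarrow> g x) (sequentially \<times>\<^sub>F nhds x)"
    and g: "continuous_on UNIV g" "\<And>x. \<bar>g x\<bar> \<le> B"
    and G: "\<And>n. G n \<in> borel_measurable borel" "\<And>n x. \<bar>G n x\<bar> \<le> B"
  shows "(\<lambda>n. \<integral>\<omega>. G n (X n \<omega>) \<partial>M n) \<longlonglongrightarrow> (\<integral>x. g x \<partial>N)"
proof -
  have B: "B \<ge> 0" using g(2)[of 0] by linarith
  have "(\<lambda>n. (\<integral>\<omega>. G n (X n \<omega>) \<partial>M n) - (\<integral>\<omega>. g (X n \<omega>) \<partial>M n)) \<longlonglongrightarrow> 0"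
  proof (rule tendstoI)
    fix e :: real assume e: "0 < e"
    \<comment> \<open>Chosen so that \<open>d + 2 * B * d = e - d < e\<close>.\<close>
    define d where "d = e / (2 * B + 2)"
    have d: "d > 0" using e B by (simp add: d_def)
    obtain K where K: "\<forall>\<^sub>F n in sequentially. measure (M n) {\<omega> \<in> space (M n). norm (X n \<omega>) > K} < d"
      using conv_in_dist_tight[OF conv N M d] .
    have "\<forall>\<^sub>F n in sequentially. \<forall>x\<in>cball 0 K. \<bar>G n x - g x\<bar> < d"
      by (rule uniform_on_compact_of_prod_filter[OF lim g(1) compact_cball d])
    then show "\<forall>\<^sub>F n in sequentially. dist ((\<integral>\<omega>. G n (X n \<omega>) \<partial>M n) - (\<integral>\<omega>. g (X n \<omega>) \<partial>M n)) 0 < e"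
      using K M
    proof eventually_elim
      case (elim n)
      then interpret prob_space "M n" by simp
      have [measurable]: "X n \<in> borel_measurable (M n)" using elim by simp
      have gm: "g \<in> borel_measurable borel" using g(1) by (rule borel_measurable_continuous_onI)
      note [measurable] = gm G(1)
      let ?A = "{\<omega> \<in> space (M n). norm (X n \<omega>) > K}"
      have iA: "integrable (M n) (indicat_real ?A)"
        by (intro integrable_const_bound[of _ 1]) auto
      have i: "integrable (M n) (\<lambda>\<omega>. G n (X n \<omega>))" "integrable (M n) (\<lambda>\<omega>. g (X n \<omega>))"
        using G(2) g(2) by (auto intro!: integrable_const_bound[of _ B])
      have "\<bar>(\<integral>\<omega>. G n (X n \<omega>) \<partial>M n) - (\<integral>\<omega>. g (X n \<omega>) \<partial>M n)\<bar> = \<bar>\<integral>\<omega>. G n (X n \<omega>) - g (X n \<omega>) \<partial>M n\<bar>"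
        using i by simp
      also have "\<dots> \<le> (\<integral>\<omega>. \<bar>G n (X n \<omega>) - g (X n \<omega>)\<bar> \<partial>M n)"
        by (rule integral_abs_bound)
      also have "\<dots> \<le> (\<integral>\<omega>. d + 2 * B * indicator ?A \<omega> \<partial>M n)"
      proof (rule integral_mono)
        fix \<omega> assume w: "\<omega> \<in> space (M n)"
        show "\<bar>G n (X n \<omega>) - g (X n \<omega>)\<bar> \<le> d + 2 * B * indicator ?A \<omega>"
        proof (cases "\<omega> \<in> ?A")
          case True
          then show ?thesis
            using G(2)[of n "X n \<omega>"] g(2)[of "X n \<omega>"] d by (simp add: abs_le_iff)
        next
          case False
          then have "X n \<omega> \<in> cball 0 K" using w by auto
          then show ?thesis using elim(1) False by force
        qed
      qed (use i iA in auto)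
      also have "\<dots> = d + 2 * B * measure (M n) ?A"
        by (subst Bochner_Integration.integral_add) (use iA in \<open>auto simp: prob_space\<close>)
      also have "\<dots> \<le> d + 2 * B * d"
        using elim B by (intro add_left_mono mult_left_mono) auto
      also have "\<dots> < e"
      proof -
        have "d * (2 * B + 2) = e" using B by (simp add: d_def)
        then show ?thesis using d by (simp add: algebra_simps)
      qed
      finally show ?case by simp
    qed
  qed
  moreover have "(\<lambda>n. \<integral>\<omega>. g (X n \<omega>) \<partial>M n) \<longlonglongrightarrow> (\<integral>x. g x \<partial>N)"
    using conv g unfolding conv_in_dist_def by (auto simp: bounded_iff)
  ultimately show ?thesis
    using tendsto_add by fastforce
qed

text \<open>Extended continuous mapping theorem; the hypothesis \<open>lim\<close> says that \<open>F n\<close> converges to \<open>l\<close>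
  locally uniformly.\<close>

lemma weak_conv_m_extended_mapping:
  fixes X :: "nat \<Rightarrow> 'a \<Rightarrow> 'b::euclidean_space" and F :: "nat \<Rightarrow> 'b \<Rightarrow> real"
  assumes conv: "conv_in_dist M X N" and N: "prob_space N" "sets N = sets borel"
    and M: "\<And>n. n \<ge> k \<Longrightarrow> prob_space (M n)" "\<And>n. n \<ge> k \<Longrightarrow> X n \<in> borel_measurable (M n)"
    and lim: "\<And>x. ((\<lambda>(n, y). F n y) \<longlongrightarrow> l x) (sequentially \<times>\<^sub>F nhds x)"
    and l: "continuous_on UNIV l" and F: "\<And>n. F n \<in> borel_measurable borel"
  shows "weak_conv_m (\<lambda>n. distr (M n) borel (\<lambda>\<omega>. F n (X n \<omega>))) (distr N borel l)"
proof -
  note [measurable] = F M(2)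
  have lm: "l \<in> borel_measurable borel" using l by (rule borel_measurable_continuous_onI)
  have [measurable]: "l \<in> borel_measurable N"
    using lm unfolding measurable_cong_sets[OF N(2) refl] .
  let ?D = "\<lambda>n. distr (M n) borel (\<lambda>\<omega>. F n (X n \<omega>))"
  have D: "real_distribution (?D (n + k))" for n
    by (intro prob_space.real_distribution_distr M) measurable
  have DN: "real_distribution (distr N borel l)"
    by (intro prob_space.real_distribution_distr N) measurable
  have M': "\<forall>\<^sub>F n in sequentially. prob_space (M n) \<and> X n \<in> borel_measurable (M n)"
    using M by (intro eventually_sequentiallyI[of k]) auto
  \<comment> \<open>The criterion asks for a \<open>real_distribution\<close> at every index, hence
    the shift by \<open>k\<close>.\<close>
  have "weak_conv_m (\<lambda>n. ?D (n + k)) (distr N borel l)"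
  proof (rule integral_cts_step_conv_imp_weak_conv[OF D DN])
    fix x y :: real assume xy: "x < y"
    have uc: "continuous_on UNIV (cts_step x y)"
      using cts_step_uniformly_continuous[OF xy] by (rule uniformly_continuous_imp_continuous)
    then have [measurable]: "cts_step x y \<in> borel_measurable borel"
      by (rule borel_measurable_continuous_onI)
    have bd: "\<bar>cts_step x y z\<bar> \<le> 1" for z
      using xy by (auto simp: cts_step_def divide_simps)
    have "((\<lambda>(n, y'). cts_step x y (F n y')) \<longlongrightarrow> cts_step x y (l x')) (sequentially \<times>\<^sub>F nhds x')" for x'
      using continuous_on_tendsto_compose[OF uc lim[of x']] by (simp add: case_prod_unfold)
    then have "(\<lambda>n. \<integral>\<omega>. cts_step x y (F n (X n \<omega>)) \<partial>M n) \<longlonglongrightarrow> (\<integral>z. cts_step x y (l z) \<partial>N)"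
      by (rule conv_in_dist_integral_of_seq[OF conv N M'])
        (auto intro!: continuous_on_compose2[OF uc l] bd)
    then have "(\<lambda>n. \<integral>\<omega>. cts_step x y (F (n + k) (X (n + k) \<omega>)) \<partial>M (n + k)) \<longlonglongrightarrow> (\<integral>z. cts_step x y (l z) \<partial>N)"
      by (rule LIMSEQ_ignore_initial_segment)
    then show "(\<lambda>n. integral\<^sup>L (?D (n + k)) (cts_step x y)) \<longlonglongrightarrow> integral\<^sup>L (distr N borel l) (cts_step x y)"
      by (simp add: integral_distr)
  qed
  then show ?thesis
    unfolding weak_conv_m_def weak_conv_def using LIMSEQ_offset by fast
qed

section \<open>Algebra of the instrumental variable model\<close>

lemma kron_row_nth: "kron_row a $ i $ p = a $ fst p * (if i = snd p then 1 else 0)"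
  by (simp add: kron_row_def kron_def rowvector_def mat_def)

lemma kron_row_mul_transpose:
  fixes a b :: "real^'m::finite"
  shows "(kron_row a :: real^('m::finite \<times> 'k::finite)^'k) ** transpose (kron_row b) = (a \<bullet> b) *\<^sub>R mat 1"
proof -
  have "(\<Sum>p\<in>UNIV. (kron_row a :: real^('m::finite \<times> 'k::finite)^'k) $ i $ p * kron_row b $ j $ p) = (if i = j then a \<bullet> b else 0)" for i j
  proof -
    have "(\<Sum>p\<in>UNIV. (kron_row a :: real^('m::finite \<times> 'k::finite)^'k) $ i $ p * kron_row b $ j $ p)
      = (\<Sum>m\<in>UNIV. \<Sum>l\<in>UNIV. if i = l then if j = l then a $ m * b $ m else 0 else 0)"
      by (subst UNIV_Times_UNIV[symmetric], subst sum.cartesian_product')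
        (intro sum.cong refl, simp add: kron_row_nth)
    also have "\<dots> = (if i = j then a \<bullet> b else 0)"
      by (simp add: inner_vec_def)
    finally show ?thesis .
  qed
  then show ?thesis
    by (simp add: matrix_matrix_mult_def vec_eq_iff mat_def transpose_def)
qed

lemma kron_row_vec_cols: "kron_row a *v vec_cols R = R *v a"
proof -
  have "(\<Sum>p\<in>UNIV. kron_row a $ i $ p * vec_cols R $ p) = (\<Sum>m\<in>UNIV. R $ i $ m * a $ m)" for i
  proof -
    have "(\<Sum>p\<in>UNIV. kron_row a $ i $ p * vec_cols R $ p)
      = (\<Sum>m\<in>UNIV. \<Sum>l\<in>UNIV. if i = l then R $ i $ m * a $ m else 0)"
      by (subst UNIV_Times_UNIV[symmetric], subst sum.cartesian_product')
        (intro sum.cong refl, simp add: kron_row_nth vec_cols_def)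
    then show ?thesis by simp
  qed
  then show ?thesis
    by (simp add: matrix_vector_mult_def vec_eq_iff)
qed

lemma transpose_kron_row_mul_nth:
  fixes a b :: "real^'m::finite"
  shows "(transpose (kron_row a) ** (kron_row b :: real^('m::finite \<times> 'k::finite)^'k)) $ p $ q
     = (if snd p = snd q then a $ fst p * b $ fst q else 0)"
proof -
  have "(\<Sum>i\<in>UNIV. (kron_row a :: real^('m::finite \<times> 'k::finite)^'k) $ i $ p * (kron_row b :: real^('m::finite \<times> 'k::finite)^'k) $ i $ q)
    = (\<Sum>i\<in>UNIV. if i = snd p then if i = snd q then a $ fst p * b $ fst q else 0 else 0)"
    by (intro sum.cong refl) (simp add: kron_row_nth)
  then show ?thesis
    by (simp add: matrix_matrix_mult_def transpose_def)
qed

text \<open>The columns of \<open>B_mat\<close> are \<open>b_vec\<close> and \<open>(0, 1)\<close>,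
  the rows of its inverse are \<open>(1, 0)\<close> and \<open>a_vec\<close>; this is the product of
  \<open>B_mat\<close> with its inverse, tensored with the identity.\<close>

lemma kron_row_dual_basis:
  "transpose (kron_row (b_vec \<beta>0)) ** kron_row (vector [1, 0])
     + transpose (kron_row (vector [0, 1])) ** kron_row (a_vec \<beta>0) = (mat 1 :: real^(2 \<times> 'k::finite)^(2 \<times> 'k::finite))"
  by (auto simp: vec_eq_iff transpose_kron_row_mul_nth mat_def a_vec_def b_vec_def forall_2)

text \<open>Turns the blocks of \<open>Sigma0\<close> into matrix products, so that later
  computations avoid indices.\<close>

lemma Sigma_block_eq_kron_row:
  "Sigma_block p q \<beta>0 \<Sigma> =
     kron_row (column p (B_mat \<beta>0)) ** \<Sigma> ** transpose (kron_row (column q (B_mat \<beta>0)))"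
  by (simp add: Sigma_block_def Sigma0_def matrix_matrix_mult_def transpose_def vec_eq_iff kron_def
      kron_row_nth column_def mat_def eq_commute)

lemma column_B_mat: "column 1 (B_mat \<beta>0) = b_vec \<beta>0" "column 2 (B_mat \<beta>0) = vector [0, 1]"
  by (simp_all add: column_def B_mat_def b_vec_def vec_eq_iff forall_2)

lemma pos_def_congruence:
  fixes \<Sigma> :: "real^'m^'m" and K :: "real^'m^'n"
  assumes "pos_def \<Sigma>" and inj: "\<And>x. transpose K *v x = 0 \<Longrightarrow> x = 0"
  shows "pos_def (K ** \<Sigma> ** transpose K)"
  unfolding pos_def_def
proof (intro conjI allI impI)
  show "transpose (K ** \<Sigma> ** transpose K) = K ** \<Sigma> ** transpose K"
    by (simp add: matrix_transpose_mul pos_def_symmetric[OF assms(1)] matrix_mul_assoc)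
  fix x :: "real^'n" assume "x \<noteq> 0"
  then have "transpose K *v x \<noteq> 0" using inj by blast
  then have "(transpose K *v x) \<bullet> (\<Sigma> *v (transpose K *v x)) > 0"
    using assms(1) unfolding pos_def_def by blast
  then show "x \<bullet> ((K ** \<Sigma> ** transpose K) *v x) > 0"
    by (simp only: inner_matrix_transpose[of x K] flip: matrix_vector_mul_assoc)
qed

text \<open>With \<open>P = matrix_inv \<Sigma>\<close> symmetric, \<open>P = P \<Sigma> P'\<close>
  is a congruence of \<open>\<Sigma>\<close>.\<close>

lemma pos_def_matrix_inv:
  fixes \<Sigma> :: "real^'m^'m"
  assumes "pos_def \<Sigma>"
  shows "pos_def (matrix_inv \<Sigma>)"
proof -
  note inv = pos_def_inverse[OF assms] and tr = transpose_matrix_inv_pos_def[OF assms]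
  have "x = 0" if "matrix_inv \<Sigma> *v x = 0" for x
    using arg_cong[OF that, of "\<lambda>y. \<Sigma> *v y"] by (simp add: matrix_vector_mul_assoc inv)
  then have "pos_def (matrix_inv \<Sigma> ** \<Sigma> ** transpose (matrix_inv \<Sigma>))"
    by (intro pos_def_congruence assms) (simp only: tr)
  then show ?thesis by (simp add: inv tr)
qed

text \<open>Applied to \<open>vec R\<close>, this is the part of the second column of \<open>R B\<^sub>0\<close> that is uncorrelated with
  the first.\<close>

definition partial_out :: "real \<Rightarrow> real^(2 \<times> 'k::finite)^(2 \<times> 'k::finite) \<Rightarrow> real^(2 \<times> 'k)^'k" where
  "partial_out \<beta>0 \<Sigma> = kron_row (vector [0, 1])
     - Sigma_block 2 1 \<beta>0 \<Sigma> ** matrix_inv (Sigma_block 1 1 \<beta>0 \<Sigma>) ** kron_row (b_vec \<beta>0)"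

lemma pos_def_kron_row_congruence:
  fixes \<Sigma> :: "real^(2 \<times> 'k::finite)^(2 \<times> 'k::finite)"
  assumes "pos_def \<Sigma>" and "e \<bullet> a = 1"
  shows "pos_def (kron_row a ** \<Sigma> ** transpose (kron_row a))"
proof (rule pos_def_congruence[OF assms(1)])
  fix x :: "real^'k" assume "transpose (kron_row a) *v x = 0"
  then have "(kron_row e ** transpose (kron_row a)) *v x = 0"
    by (simp only: matrix_vector_mul_assoc[symmetric] matrix_vector_mult_0_right)
  then show "x = 0" by (simp add: kron_row_mul_transpose assms)
qed

lemma inner_2: "x \<bullet> y = x $ 1 * y $ 1 + x $ 2 * y $ 2" for x y :: "real^2"
  by (simp add: inner_vec_def UNIV_2)

context
  fixes \<Sigma> :: "real^(2 \<times> 'k::finite)^(2 \<times> 'k::finite)" and \<beta>0 :: real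
  assumes \<Sigma>: "pos_def \<Sigma>"
begin

lemma pos_def_Sigma_block_11: "pos_def (Sigma_block 1 1 \<beta>0 \<Sigma>)"
  unfolding Sigma_block_eq_kron_row column_B_mat
  by (rule pos_def_kron_row_congruence[OF \<Sigma>, of "vector [1, 0]"]) (simp add: inner_2 b_vec_def)

lemma transpose_Sigma_block: "transpose (Sigma_block p q \<beta>0 \<Sigma>) = Sigma_block q p \<beta>0 \<Sigma>"
  by (simp add: Sigma_block_eq_kron_row matrix_transpose_mul pos_def_symmetric[OF \<Sigma>] matrix_mul_assoc)

text \<open>Subtracting the regression on the first column removes the covariance with it.\<close>

lemma partial_out_uncorrelated: "partial_out \<beta>0 \<Sigma> ** \<Sigma> ** transpose (kron_row (b_vec \<beta>0)) = 0"
proof -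
  have "partial_out \<beta>0 \<Sigma> ** \<Sigma> ** transpose (kron_row (b_vec \<beta>0)) =
    Sigma_block 2 1 \<beta>0 \<Sigma> - Sigma_block 2 1 \<beta>0 \<Sigma> ** (matrix_inv (Sigma_block 1 1 \<beta>0 \<Sigma>) ** Sigma_block 1 1 \<beta>0 \<Sigma>)"
    unfolding partial_out_def Sigma_block_eq_kron_row column_B_mat matrix_diff_rdistrib matrix_mul_assoc ..
  then show ?thesis by (simp add: pos_def_inverse[OF pos_def_Sigma_block_11])
qed

text \<open>\<open>a_vec\<close> is orthogonal to \<open>b_vec\<close> and has second entry
  1.\<close>

lemma partial_out_a: "partial_out \<beta>0 \<Sigma> ** transpose (kron_row (a_vec \<beta>0)) = mat 1"
proof -
  have "partial_out \<beta>0 \<Sigma> ** transpose (kron_row (a_vec \<beta>0)) =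
     kron_row (vector [0, 1]) ** transpose (kron_row (a_vec \<beta>0))
     - Sigma_block 2 1 \<beta>0 \<Sigma> ** matrix_inv (Sigma_block 1 1 \<beta>0 \<Sigma>) ** (kron_row (b_vec \<beta>0) ** transpose (kron_row (a_vec \<beta>0)))"
    unfolding partial_out_def matrix_diff_rdistrib matrix_mul_assoc ..
  then show ?thesis
    by (simp add: kron_row_mul_transpose inner_2 a_vec_def b_vec_def)
qed

text \<open>Inserting the dual basis identity to the right of
  \<open>partial_out \<beta>0 \<Sigma> ** \<Sigma>\<close>, the \<open>b_vec\<close> part vanishes
  by uncorrelatedness and the other part is the Schur complement \<open>C\<close> times
  \<open>kron_row (a_vec \<beta>0)\<close>. Cancelling \<open>\<Sigma>\<close> and using
  \<open>partial_out_a\<close> then identifies the inverse of \<open>C\<close>.\<close>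

lemma partial_out_factorization:
  defines "C \<equiv> Sigma_block 2 2 \<beta>0 \<Sigma> -
     Sigma_block 2 1 \<beta>0 \<Sigma> ** matrix_inv (Sigma_block 1 1 \<beta>0 \<Sigma>) ** Sigma_block 1 2 \<beta>0 \<Sigma>"
  shows "partial_out \<beta>0 \<Sigma> ** \<Sigma> = C ** kron_row (a_vec \<beta>0)"
    "C ** (kron_row (a_vec \<beta>0) ** matrix_inv \<Sigma> ** transpose (kron_row (a_vec \<beta>0))) = mat 1"
    "partial_out \<beta>0 \<Sigma> = C ** kron_row (a_vec \<beta>0) ** matrix_inv \<Sigma>"
proof -
  let ?W = "partial_out \<beta>0 \<Sigma>" and ?A = "kron_row (a_vec \<beta>0) :: real^(2 \<times> 'k)^'k"
  let ?E = "kron_row (vector [0, 1]) :: real^(2 \<times> 'k)^'k" and ?B = "kron_row (b_vec \<beta>0) :: real^(2 \<times> 'k)^'k"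
  have WE: "?W ** \<Sigma> ** transpose ?E = C"
    unfolding C_def partial_out_def Sigma_block_eq_kron_row column_B_mat matrix_diff_rdistrib matrix_mul_assoc ..
  have "?W ** \<Sigma> = ?W ** \<Sigma> ** (transpose ?B ** kron_row (vector [1, 0]) + transpose ?E ** ?A)"
    by (simp add: kron_row_dual_basis)
  also have "\<dots> = (?W ** \<Sigma> ** transpose ?B) ** kron_row (vector [1, 0]) + (?W ** \<Sigma> ** transpose ?E) ** ?A"
    by (simp only: matrix_add_ldistrib matrix_mul_assoc)
  also have "\<dots> = C ** ?A"
    unfolding partial_out_uncorrelated WE by (simp add: vec_eq_iff matrix_matrix_mult_def)
  finally show 1: "?W ** \<Sigma> = C ** ?A" .
  have "?W = ?W ** (\<Sigma> ** matrix_inv \<Sigma>)"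
    by (simp add: pos_def_inverse[OF \<Sigma>])
  also have "\<dots> = C ** ?A ** matrix_inv \<Sigma>"
    by (simp only: matrix_mul_assoc 1)
  finally show 2: "?W = C ** ?A ** matrix_inv \<Sigma>" .
  have "C ** (?A ** matrix_inv \<Sigma> ** transpose ?A) = C ** ?A ** matrix_inv \<Sigma> ** transpose ?A"
    by (simp only: matrix_mul_assoc)
  also have "\<dots> = mat 1"
    by (simp only: 2[symmetric] partial_out_a)
  finally show "C ** (?A ** matrix_inv \<Sigma> ** transpose ?A) = mat 1" .
qed

text \<open>The matrix under the root in \<open>T_stat\<close> is the inverse of the Schur
  complement, so the normalization of \<open>T_stat\<close> and the weight in \<open>LM1\<close> are
  the same inverse root.\<close>

lemma Sigma_sup22_eq:
  "Sigma_sup22 \<beta>0 \<Sigma> = kron_row (a_vec \<beta>0) ** matrix_inv \<Sigma> ** transpose (kron_row (a_vec \<beta>0))"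
  unfolding Sigma_sup22_def by (rule matrix_inv_unique) (rule partial_out_factorization(2))

lemma pos_def_Sigma_sup22: "pos_def (Sigma_sup22 \<beta>0 \<Sigma>)"
  unfolding Sigma_sup22_eq
  by (rule pos_def_kron_row_congruence[OF pos_def_matrix_inv[OF \<Sigma>], of "vector [0, 1]"]) (simp add: inner_2 a_vec_def)

lemma matrix_inv_Sigma_sup22:
  "matrix_inv (Sigma_sup22 \<beta>0 \<Sigma>) = Sigma_block 2 2 \<beta>0 \<Sigma> -
     Sigma_block 2 1 \<beta>0 \<Sigma> ** matrix_inv (Sigma_block 1 1 \<beta>0 \<Sigma>) ** Sigma_block 1 2 \<beta>0 \<Sigma>"
  using partial_out_factorization(2) unfolding Sigma_sup22_eq
  by (intro matrix_inv_unique) (metis matrix_left_right_inverse)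

lemma partial_out_eq: "partial_out \<beta>0 \<Sigma> = matrix_inv (Sigma_sup22 \<beta>0 \<Sigma>) ** kron_row (a_vec \<beta>0) ** matrix_inv \<Sigma>"
  unfolding matrix_inv_Sigma_sup22 by (rule partial_out_factorization(3))

lemma partial_out_covariance:
  "partial_out \<beta>0 \<Sigma> ** \<Sigma> ** transpose (partial_out \<beta>0 \<Sigma>) = matrix_inv (Sigma_sup22 \<beta>0 \<Sigma>)"
proof -
  have "kron_row (a_vec \<beta>0) ** transpose (partial_out \<beta>0 \<Sigma>) = transpose (partial_out \<beta>0 \<Sigma> ** transpose (kron_row (a_vec \<beta>0)))"
    by (simp add: matrix_transpose_mul)
  also have "\<dots> = mat 1" by (simp add: partial_out_a)
  finally show ?thesis
    unfolding partial_out_factorization(1) matrix_inv_Sigma_sup22 matrix_mul_assoc[symmetric] by simp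
qed

lemma partial_out_vec_cols:
  "partial_out \<beta>0 \<Sigma> *v vec_cols R = R *v vector [0, 1]
     - (Sigma_block 2 1 \<beta>0 \<Sigma> ** matrix_inv (Sigma_block 1 1 \<beta>0 \<Sigma>)) *v (R *v b_vec \<beta>0)"
  unfolding partial_out_def matrix_vector_mult_diff_rdistrib kron_row_vec_cols
  by (simp add: kron_row_vec_cols flip: matrix_vector_mul_assoc)

text \<open>The two inverse roots of \<open>Sigma_sup22\<close> multiply to its inverse, which turns
  the weighted \<open>T_stat\<close> into the regression residual.\<close>

lemma LM1_eq:
  "LM1 \<beta>0 \<Sigma> R = (inv_msqrt (Sigma_block 1 1 \<beta>0 \<Sigma>) *v (R *v b_vec \<beta>0))
       \<bullet> (inv_msqrt (Sigma_block 1 1 \<beta>0 \<Sigma>) *v (partial_out \<beta>0 \<Sigma> *v vec_cols R))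
     / norm (inv_msqrt (Sigma_block 1 1 \<beta>0 \<Sigma>) *v (partial_out \<beta>0 \<Sigma> *v vec_cols R))"
proof -
  have S: "S_stat \<beta>0 \<Sigma> R = inv_msqrt (Sigma_block 1 1 \<beta>0 \<Sigma>) *v (R *v b_vec \<beta>0)"
    by (simp add: S_stat_def Let_def kron_row_vec_cols Sigma_block_eq_kron_row column_B_mat)
  have T: "inv_msqrt (Sigma_sup22 \<beta>0 \<Sigma>) *v T_stat \<beta>0 \<Sigma> R = partial_out \<beta>0 \<Sigma> *v vec_cols R"
    unfolding T_stat_def Let_def Sigma_sup22_eq[symmetric] matrix_vector_mul_assoc
    by (simp add: inv_msqrt_pos_def(5)[OF pos_def_Sigma_sup22] partial_out_eq matrix_mul_assoc)
  show ?thesis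
    by (simp add: LM1_def Let_def S T)
qed

end

section \<open>Sample cross products and the signal contained in \<open>R_stat\<close>\<close>

lemma cross_mult_vec: "cross n X W *v c = (\<Sum>i<n. (W i \<bullet> c) *\<^sub>R X i)"
proof -
  have "(\<Sum>b\<in>UNIV. (\<Sum>i<n. X i $ a * W i $ b) * c $ b) = (\<Sum>i<n. (\<Sum>b\<in>UNIV. W i $ b * c $ b) * X i $ a)" for a
    by (simp add: sum_distrib_right, subst sum.swap) (simp add: mult_ac)
  then show ?thesis
    by (simp add: cross_def matrix_vector_mult_def vec_eq_iff inner_vec_def)
qed

lemma pos_def_cross:
  assumes "full_column_rank n Z"
  shows "pos_def (cross n Z Z)"
  unfolding pos_def_def
proof (intro conjI allI impI)
  show "transpose (cross n Z Z) = cross n Z Z"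
    by (simp add: cross_def transpose_def vec_eq_iff mult.commute)
  fix x :: "real^'a" assume "x \<noteq> 0"
  then obtain j where j: "j < n" "Z j \<bullet> x \<noteq> 0"
    using assms unfolding full_column_rank_def by blast
  have "x \<bullet> (cross n Z Z *v x) = (\<Sum>i<n. (Z i \<bullet> x)\<^sup>2)"
    by (simp add: cross_mult_vec inner_sum_right power2_eq_square inner_commute)
  also have "\<dots> > 0" using j by (intro sum_pos2[of _ j]) auto
  finally show "x \<bullet> (cross n Z Z *v x) > 0" .
qed

text \<open>The signal is \<open>\<mu>\<close> because \<open>inv_msqrt A ** A = msqrt A\<close> for
  \<open>A = cross n Z Z\<close>.\<close>

lemma R_stat_mult_vec:
  assumes "full_column_rank n Z" and Y: "\<And>i. i < n \<Longrightarrow> Y i = (Z i \<bullet> \<pi>) *\<^sub>R a + V i"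
  shows "R_stat n Z Y *v c = (a \<bullet> c) *\<^sub>R (msqrt (cross n Z Z) *v \<pi>)
     + (inv_msqrt (cross n Z Z) ** cross n Z V) *v c"
proof -
  have "cross n Z Y *v c = (a \<bullet> c) *\<^sub>R (cross n Z Z *v \<pi>) + cross n Z V *v c"
    by (simp add: cross_mult_vec Y inner_add_left scaleR_add_left sum.distrib scaleR_sum_right mult.commute)
  then show ?thesis
    unfolding R_stat_def matrix_vector_mul_assoc[symmetric]
    by (simp add: matrix_vector_right_distrib matrix_vector_mult_scaleR
        inv_msqrt_pos_def(4)[OF pos_def_cross[OF assms(1)]] matrix_vector_mul_assoc)
qed

section \<open>Asymptotics of the centered statistic\<close>

lemma tendsto_matrix_vector_mult:
  fixes A :: "'b \<Rightarrow> real^'n^'m"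
  assumes "(A \<longlongrightarrow> B) F"
  shows "((\<lambda>t. A t *v x) \<longlongrightarrow> B *v x) F"
proof -
  have "linear (\<lambda>A :: real^'n^'m. A *v x)"
    by (auto intro!: linearI simp: matrix_vector_mult_add_rdistrib scaleR_matrix_vector_assoc)
  then have "bounded_linear (\<lambda>A :: real^'n^'m. A *v x)"
    by (simp add: linear_conv_bounded_linear)
  then show ?thesis using assms by (rule bounded_linear.tendsto)
qed

text \<open>The model constrains only sample sizes from \<open>CARD('k)\<close> on; finitely many
  initial laws do not affect the limit.\<close>

lemma weak_conv_m_cong:
  assumes "\<And>n. n \<ge> k \<Longrightarrow> P n = Q n"
  shows "weak_conv_m P N = weak_conv_m Q N"
proof -
  have "(\<lambda>n. cdf (P n) x) \<longlonglongrightarrow> L \<longleftrightarrow> (\<lambda>n. cdf (Q n) x) \<longlonglongrightarrow> L" for x L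
    by (intro tendsto_cong eventually_sequentiallyI[of k]) (simp add: assms)
  then show ?thesis unfolding weak_conv_m_def weak_conv_def by simp
qed

text \<open>Both quotients may diverge like \<open>1 / S\<close>. Their difference stays bounded
  since \<open>norm (G + Y)\<close> and \<open>norm G\<close>, rescaled by \<open>S\<close>, differ
  only by a multiple of \<open>S\<close>. A general filter is used so that the product filter is
  covered.\<close>

lemma tendsto_normalized_inner_diff:
  fixes S :: "'p \<Rightarrow> real" and H G X Y :: "'p \<Rightarrow> 'e::real_inner"
  assumes S: "(S \<longlongrightarrow> 0) P" "\<forall>\<^sub>F p in P. S p > 0"
    and H: "((\<lambda>p. S p *\<^sub>R H p) \<longlongrightarrow> h) P" and G: "((\<lambda>p. S p *\<^sub>R G p) \<longlongrightarrow> g) P" "g \<noteq> 0"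
    and X: "(X \<longlongrightarrow> x) P" and Y: "(Y \<longlongrightarrow> y) P"
  shows "((\<lambda>p. ((\<Delta> *\<^sub>R H p + X p) \<bullet> (G p + Y p)) / norm (G p + Y p) - \<Delta> * (H p \<bullet> G p) / norm (G p))
     \<longlongrightarrow> (x \<bullet> g) / norm g + \<Delta> / norm g * (h \<bullet> y - (h \<bullet> g) * (g \<bullet> y) / (norm g)\<^sup>2)) P"
proof -
  define H' where "H' p = S p *\<^sub>R H p" for p
  define G' where "G' p = S p *\<^sub>R G p" for p
  define W where "W p = G' p + S p *\<^sub>R Y p" for p
  note H' = H[folded H'_def] and G' = G(1)[folded G'_def]
  have W: "(W \<longlongrightarrow> g) P"
    using tendsto_add[OF G' tendsto_scaleR[OF S(1) Y]] unfolding W_def by simp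
  \<comment> \<open>With \<open>w = norm (W p)\<close> and \<open>n = norm (G' p)\<close>, the
    difference \<open>1 / n - 1 / w\<close> is rationalized to
    \<open>(w^2 - n^2) / (w n (w + n))\<close>. The factor \<open>S p\<close> of
    \<open>w^2 - n^2\<close> is cancelled, so every term of \<open>\<Psi>\<close> converges.\<close>
  define \<Psi> where "\<Psi> p = (X p \<bullet> W p) / norm (W p) + \<Delta> * ((H' p \<bullet> Y p) / norm (W p)
      - (H' p \<bullet> G' p) * (2 * (G' p \<bullet> Y p) + S p * (Y p \<bullet> Y p)) / (norm (W p) * norm (G' p) * (norm (W p) + norm (G' p))))" for p
  have "(\<Psi> \<longlongrightarrow> (x \<bullet> g) / norm g + \<Delta> * ((h \<bullet> y) / norm g
      - (h \<bullet> g) * (2 * (g \<bullet> y) + 0 * (y \<bullet> y)) / (norm g * norm g * (norm g + norm g)))) P"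
    unfolding \<Psi>_def using G(2) by (intro tendsto_intros X Y W H' G' S(1)) auto
  also have "(x \<bullet> g) / norm g + \<Delta> * ((h \<bullet> y) / norm g
      - (h \<bullet> g) * (2 * (g \<bullet> y) + 0 * (y \<bullet> y)) / (norm g * norm g * (norm g + norm g)))
    = (x \<bullet> g) / norm g + \<Delta> / norm g * (h \<bullet> y - (h \<bullet> g) * (g \<bullet> y) / (norm g)\<^sup>2)"
    using G(2) by (simp add: field_simps power2_eq_square)
  finally have lim: "(\<Psi> \<longlongrightarrow> (x \<bullet> g) / norm g + \<Delta> / norm g * (h \<bullet> y - (h \<bullet> g) * (g \<bullet> y) / (norm g)\<^sup>2)) P" .
  have "\<forall>\<^sub>F p in P. W p \<noteq> 0" "\<forall>\<^sub>F p in P. G' p \<noteq> 0"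
    using W G' G(2) by (simp_all add: tendsto_imp_eventually_ne)
  with S(2) have "\<forall>\<^sub>F p in P. \<Psi> p = ((\<Delta> *\<^sub>R H p + X p) \<bullet> (G p + Y p)) / norm (G p + Y p) - \<Delta> * (H p \<bullet> G p) / norm (G p)"
  proof eventually_elim
    case (elim p)
    define s where "s = S p"
    define w where "w = norm (W p)"
    define n where "n = norm (G' p)"
    have s: "s > 0" and pos: "w > 0" "n > 0" using elim by (simp_all add: s_def w_def n_def)
    have Hp: "H p = H' p /\<^sub>R s" and Gp: "G p = G' p /\<^sub>R s" using s by (simp_all add: H'_def G'_def s_def)
    have GY: "G p + Y p = W p /\<^sub>R s" using s by (simp add: W_def Gp s_def scaleR_add_right)
    have "w\<^sup>2 = n\<^sup>2 + s * (2 * (G' p \<bullet> Y p) + s * (Y p \<bullet> Y p))"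
      by (simp add: w_def n_def W_def power2_norm_eq_inner inner_add_left inner_add_right s_def
          inner_commute[of "Y p" "G' p"] algebra_simps)
    then have d: "2 * (G' p \<bullet> Y p) + s * (Y p \<bullet> Y p) = (w - n) * (w + n) / s"
      using s by (simp add: field_simps power2_eq_square)
    have "(H' p \<bullet> G' p) * (2 * (G' p \<bullet> Y p) + s * (Y p \<bullet> Y p)) / (w * n * (w + n))
        = (H' p \<bullet> G' p) * (1 / n - 1 / w) / s"
      unfolding d using s pos by (simp add: divide_simps)
    then have L: "\<Psi> p = (X p \<bullet> W p) / w + \<Delta> * ((H' p \<bullet> Y p) / w - (H' p \<bullet> G' p) * (1 / n - 1 / w) / s)"
      by (simp add: \<Psi>_def w_def n_def s_def)
    have "((\<Delta> *\<^sub>R H p + X p) \<bullet> (G p + Y p)) / norm (G p + Y p) = ((\<Delta> *\<^sub>R H p + X p) \<bullet> W p) / w"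
      using s by (simp add: GY w_def)
    also have "\<dots> = (X p \<bullet> W p) / w + \<Delta> * (H' p \<bullet> G' p + s * (H' p \<bullet> Y p)) / (s * w)"
      using s pos by (simp add: Hp inner_add_left add_divide_distrib divide_inverse)
        (simp add: W_def s_def inner_add_right algebra_simps)
    finally have R1: "((\<Delta> *\<^sub>R H p + X p) \<bullet> (G p + Y p)) / norm (G p + Y p)
      = (X p \<bullet> W p) / w + \<Delta> * (H' p \<bullet> G' p + s * (H' p \<bullet> Y p)) / (s * w)" .
    have R2: "\<Delta> * (H p \<bullet> G p) / norm (G p) = \<Delta> * (H' p \<bullet> G' p) / (s * n)"
      using s by (simp add: Hp Gp n_def divide_simps)
    show ?case
      unfolding R1 R2 L using s pos by (simp add: field_simps)
  qed
  then show ?thesis using lim by (rule Lim_transform_eventually[rotated])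
qed

section \<open>Measurability of vector-valued maps\<close>

lemma borel_measurable_vec:
  fixes f :: "'a \<Rightarrow> real^'n"
  assumes "\<And>i. (\<lambda>x. f x $ i) \<in> borel_measurable M"
  shows "f \<in> borel_measurable M"
proof (subst borel_measurable_euclidean_space, rule ballI)
  fix b :: "real^'n" assume "b \<in> Basis"
  then obtain i where "b = axis i 1" unfolding Basis_vec_def by auto
  then show "(\<lambda>x. f x \<bullet> b) \<in> borel_measurable M"
    using assms[of i] by (simp add: inner_axis)
qed

lemma borel_measurable_vec_nth:
  fixes f :: "'a \<Rightarrow> real^'n"
  assumes "f \<in> borel_measurable M"
  shows "(\<lambda>x. f x $ i) \<in> borel_measurable M"
proof -
  have "(\<lambda>x. f x \<bullet> axis i 1) \<in> borel_measurable M"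
    using assms by (intro borel_measurable_inner) auto
  then show ?thesis by (simp add: inner_axis)
qed

lemma borel_measurable_vec_cols_cross:
  assumes "\<And>i. i < n \<Longrightarrow> (\<lambda>\<omega>. V \<omega> i) \<in> borel_measurable M"
  shows "(\<lambda>\<omega>. vec_cols (A ** cross n Z (V \<omega>))) \<in> borel_measurable M"
proof (rule borel_measurable_vec)
  fix p
  have "(\<lambda>\<omega>. \<Sum>k\<in>UNIV. A $ snd p $ k * (\<Sum>i<n. Z i $ k * V \<omega> i $ fst p)) \<in> borel_measurable M"
    by (intro borel_measurable_sum borel_measurable_times borel_measurable_const borel_measurable_vec_nth assms) auto
  then show "(\<lambda>\<omega>. vec_cols (A ** cross n Z (V \<omega>)) $ p) \<in> borel_measurable M"
    by (simp add: vec_cols_def matrix_matrix_mult_def cross_def)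
qed

theorem corollary1:
  fixes M :: "nat \<Rightarrow> 'a measure"
    and Z :: "nat \<Rightarrow> nat \<Rightarrow> real^'k"
    and Y V :: "nat \<Rightarrow> 'a \<Rightarrow> nat \<Rightarrow> real^2"
    and \<pi> :: "real^'k" and \<beta>s \<beta>0 \<Delta> :: real
    and D :: "real^'k^'k" and \<Omega> :: "real^2^2" and \<Sigma> :: "real^(2 \<times> 'k::finite)^(2 \<times> 'k::finite)"
    and \<Sigma>11 \<Sigma>12 \<Sigma>21 \<Sigma>sup22 M\<gamma> :: "real^'k^'k"
    and \<mu> :: "nat \<Rightarrow> real^'k" and \<gamma> :: "real^'k"
  assumes model: "\<forall>n\<ge>CARD('k). iv_model n (M n) (Z n) (Y n) (V n) \<pi> \<beta>s"
    and NA: "assumption_NA M Z V D \<Omega> \<Sigma>"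
    and "\<Delta> = \<beta>s - \<beta>0"
    and "\<pi> \<noteq> 0"
    and "\<Sigma>11 = Sigma_block 1 1 \<beta>0 \<Sigma>"
    and "\<Sigma>12 = Sigma_block 1 2 \<beta>0 \<Sigma>"
    and "\<Sigma>21 = Sigma_block 2 1 \<beta>0 \<Sigma>"
    and "\<Sigma>sup22 = Sigma_sup22 \<beta>0 \<Sigma>"
    and "\<And>n. \<mu> n = msqrt (cross n (Z n) (Z n)) *v \<pi>"
    and impossibility_design:
      "\<forall>n\<ge>CARD('k). \<mu> n \<bullet> ((matrix_inv \<Sigma>11 ** \<Sigma>21 ** matrix_inv \<Sigma>11) *v \<mu> n) = 0"
    and "\<gamma> = (inv_msqrt \<Sigma>11 ** (mat 1 - \<Delta> *\<^sub>R (\<Sigma>21 ** matrix_inv \<Sigma>11)) ** msqrt D) *v \<pi>"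
    and "M\<gamma> = mat 1 - (1 / (norm \<gamma>)\<^sup>2) *\<^sub>R ((columnvector \<gamma> :: real^1^'k) ** (rowvector \<gamma> :: real^'k^1))"
  shows "weak_conv_m
    (\<lambda>n. distr (M n) borel (\<lambda>\<omega>.
        LM1 \<beta>0 \<Sigma> (R_stat n (Z n) (Y n \<omega>))
        - \<Delta> * (\<mu> n \<bullet> (matrix_inv \<Sigma>11 *v \<mu> n))
          / sqrt (\<mu> n \<bullet> (matrix_inv \<Sigma>11 *v \<mu> n)
              + \<Delta>\<^sup>2 * (\<mu> n \<bullet> ((matrix_inv \<Sigma>11 ** \<Sigma>12 ** matrix_inv \<Sigma>11
                           ** \<Sigma>21 ** matrix_inv \<Sigma>11) *v \<mu> n)))))
    (density lborel (normal_density 0 (sqrt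
       (1 + \<Delta>\<^sup>2 / (norm \<gamma>)\<^sup>2 *
          (\<pi> \<bullet> ((msqrt D ** inv_msqrt \<Sigma>11 ** M\<gamma> ** inv_msqrt \<Sigma>11 ** matrix_inv \<Sigma>sup22
                ** inv_msqrt \<Sigma>11 ** M\<gamma> ** inv_msqrt \<Sigma>11 ** msqrt D) *v \<pi>))))))"
proof -
  note \<Delta> = assms(3) and \<mu> = assms(9) and \<gamma>_def = assms(11) and M\<gamma> = assms(12)
  note S11 = assms(5) and S12 = assms(6) and S21 = assms(7) and Ssup = assms(8)
  have \<Sigma>: "pos_def \<Sigma>" and D: "pos_def D"
    and Dlim: "(\<lambda>n. (1 / real n) *\<^sub>R cross n (Z n) (Z n)) \<longlonglongrightarrow> D"
    using NA by (simp_all add: assumption_NA_def)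
  define X where "X n \<omega> = vec_cols (inv_msqrt (cross n (Z n) (Z n)) ** cross n (Z n) (V n \<omega>))" for n \<omega>
  have conv: "conv_in_dist M X (mvn \<Sigma>)"
    using NA by (simp add: assumption_NA_def X_def[abs_def])
  have prob: "prob_space (M n)" and rank: "full_column_rank n (Z n)"
    and Vm: "i < n \<Longrightarrow> (\<lambda>\<omega>. V n \<omega> i) \<in> borel_measurable (M n)"
    and Y: "\<omega> \<in> space (M n) \<Longrightarrow> i < n \<Longrightarrow> Y n \<omega> i = (Z n i \<bullet> \<pi>) *\<^sub>R vector [\<beta>s, 1] + V n \<omega> i"
    if "n \<ge> CARD('k)" for n i \<omega>
    using model that by (auto simp: iv_model_def intro!: borel_measurable_integrable)
  have Xm: "X n \<in> borel_measurable (M n)" if "n \<ge> CARD('k)" for n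
    unfolding X_def[abs_def] by (rule borel_measurable_vec_cols_cross) (use Vm that in blast)
  have "\<forall>\<^sub>F n in sequentially. prob_space (M n)"
    using prob by (rule eventually_sequentiallyI)
  then have mvn_prob: "prob_space (mvn \<Sigma>)"
    by (rule prob_space_conv_in_dist_limit[OF conv])
  have mvn_sets: "sets (mvn \<Sigma>) = sets borel" by (simp add: mvn_def)

  \<comment> \<open>Signal vectors and the design condition\<close>
  define J where "J = inv_msqrt \<Sigma>11"
  define N where "N = \<Sigma>21 ** matrix_inv \<Sigma>11"
  define W where "W = partial_out \<beta>0 \<Sigma>"
  define B where "B = (kron_row (b_vec \<beta>0) :: real^(2 \<times> 'k)^'k)"
  define C where "C = matrix_inv \<Sigma>sup22"
  define S where "S n = 1 / sqrt (real n)" for n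
  define h where "h n = J *v \<mu> n" for n
  define g where "g n = h n - \<Delta> *\<^sub>R (J *v (N *v \<mu> n))" for n
  define h0 where "h0 = J *v (msqrt D *v \<pi>)"
  have S11_pd: "pos_def \<Sigma>11" unfolding S11 by (rule pos_def_Sigma_block_11[OF \<Sigma>])
  note J = inv_msqrt_pos_def[OF S11_pd, folded J_def]
  have Jt: "x \<bullet> (J *v y) = (J *v x) \<bullet> y" for x y
    by (simp only: inner_matrix_transpose J(1))
  have JJ: "J *v (J *v x) = matrix_inv \<Sigma>11 *v x" for x
    by (simp add: matrix_vector_mul_assoc J(5))
  have Nt: "transpose N = matrix_inv \<Sigma>11 ** \<Sigma>12"
    by (simp add: N_def matrix_transpose_mul transpose_matrix_inv_pos_def[OF S11_pd] S12 S21 transpose_Sigma_block[OF \<Sigma>])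
  have g_alt: "g n = J *v (\<mu> n - \<Delta> *\<^sub>R (N *v \<mu> n))" for n
    by (simp add: g_def h_def matrix_vector_mult_diff_distrib matrix_vector_mult_scaleR)

  have hh: "h n \<bullet> h n = \<mu> n \<bullet> (matrix_inv \<Sigma>11 *v \<mu> n)" for n
    by (simp add: h_def Jt[symmetric] JJ inner_commute)
  \<comment> \<open>Moving the symmetric \<open>J\<close> across the inner product turns this into
    the design condition.\<close>
  have hN: "h n \<bullet> (J *v (N *v \<mu> n)) = 0" if "n \<ge> CARD('k)" for n
  proof -
    have "h n \<bullet> (J *v (N *v \<mu> n)) = \<mu> n \<bullet> (matrix_inv \<Sigma>11 *v (N *v \<mu> n))"
      unfolding h_def Jt[symmetric] JJ ..
    also have "\<dots> = \<mu> n \<bullet> ((matrix_inv \<Sigma>11 ** \<Sigma>21 ** matrix_inv \<Sigma>11) *v \<mu> n)"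
      by (simp only: N_def matrix_vector_mul_assoc matrix_mul_assoc)
    also have "\<dots> = 0" using impossibility_design that by blast
    finally show ?thesis .
  qed
  have hg: "h n \<bullet> g n = h n \<bullet> h n" if "n \<ge> CARD('k)" for n
    using hN[OF that] by (simp add: g_def inner_diff_right)
  have NN: "(J *v (N *v \<mu> n)) \<bullet> (J *v (N *v \<mu> n)) = \<mu> n \<bullet> ((matrix_inv \<Sigma>11 ** \<Sigma>12 ** matrix_inv \<Sigma>11
                           ** \<Sigma>21 ** matrix_inv \<Sigma>11) *v \<mu> n)" for n
  proof -
    have "(J *v (N *v \<mu> n)) \<bullet> (J *v (N *v \<mu> n)) = (N *v \<mu> n) \<bullet> (matrix_inv \<Sigma>11 *v (N *v \<mu> n))"
      unfolding Jt[symmetric] JJ ..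
    also have "\<dots> = \<mu> n \<bullet> (transpose N *v (matrix_inv \<Sigma>11 *v (N *v \<mu> n)))"
      by (simp only: inner_matrix_transpose[of "\<mu> n" "transpose N"] transpose_transpose)
    also have "\<dots> = \<mu> n \<bullet> ((matrix_inv \<Sigma>11 ** \<Sigma>12 ** matrix_inv \<Sigma>11
                           ** \<Sigma>21 ** matrix_inv \<Sigma>11) *v \<mu> n)"
      unfolding Nt by (simp only: N_def matrix_vector_mul_assoc matrix_mul_assoc)
    finally show ?thesis .
  qed
  have norm_g: "norm (g n) = sqrt (\<mu> n \<bullet> (matrix_inv \<Sigma>11 *v \<mu> n)
              + \<Delta>\<^sup>2 * (\<mu> n \<bullet> ((matrix_inv \<Sigma>11 ** \<Sigma>12 ** matrix_inv \<Sigma>11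
                           ** \<Sigma>21 ** matrix_inv \<Sigma>11) *v \<mu> n)))" if "n \<ge> CARD('k)" for n
  proof -
    have "g n \<bullet> g n = h n \<bullet> h n + \<Delta>\<^sup>2 * ((J *v (N *v \<mu> n)) \<bullet> (J *v (N *v \<mu> n)))"
      using hN[OF that] by (simp add: g_def inner_diff_left inner_diff_right power2_eq_square inner_commute)
    then show ?thesis by (simp add: norm_eq_sqrt_inner hh NN)
  qed

  \<comment> \<open>The centered statistic as a function of the normalized errors\<close>
  define F where "F n x = ((\<Delta> *\<^sub>R h n + J *v (B *v x)) \<bullet> (g n + J *v (W *v x))) / norm (g n + J *v (W *v x))
      - \<Delta> * (h n \<bullet> g n) / norm (g n)" for n x
  have LM1_F: "LM1 \<beta>0 \<Sigma> (R_stat n (Z n) (Y n \<omega>))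
        - \<Delta> * (\<mu> n \<bullet> (matrix_inv \<Sigma>11 *v \<mu> n))
          / sqrt (\<mu> n \<bullet> (matrix_inv \<Sigma>11 *v \<mu> n)
              + \<Delta>\<^sup>2 * (\<mu> n \<bullet> ((matrix_inv \<Sigma>11 ** \<Sigma>12 ** matrix_inv \<Sigma>11
                           ** \<Sigma>21 ** matrix_inv \<Sigma>11) *v \<mu> n))) = F n (X n \<omega>)"
    if n: "n \<ge> CARD('k)" and w: "\<omega> \<in> space (M n)" for n \<omega>
  proof -
    let ?U = "inv_msqrt (cross n (Z n) (Z n)) ** cross n (Z n) (V n \<omega>)"
    let ?R = "R_stat n (Z n) (Y n \<omega>)"
    have R: "?R *v c = (vector [\<beta>s, 1] \<bullet> c) *\<^sub>R \<mu> n + ?U *v c" for c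
      unfolding \<mu> by (rule R_stat_mult_vec[OF rank[OF n] Y[OF n w]])
    have Rb: "?R *v b_vec \<beta>0 = \<Delta> *\<^sub>R \<mu> n + B *v X n \<omega>"
      unfolding R B_def X_def kron_row_vec_cols by (simp add: inner_2 b_vec_def \<Delta>)
    have "W *v vec_cols ?R = ?R *v vector [0, 1] - N *v (?R *v b_vec \<beta>0)"
      by (simp only: W_def N_def S11 S21 partial_out_vec_cols[OF \<Sigma>])
    also have "\<dots> = (\<mu> n - \<Delta> *\<^sub>R (N *v \<mu> n)) + (?U *v vector [0, 1] - N *v (B *v X n \<omega>))"
      unfolding Rb R[of "vector [0, 1]"] by (simp add: inner_2 matrix_vector_right_distrib matrix_vector_mult_scaleR)
    also have "?U *v vector [0, 1] - N *v (B *v X n \<omega>) = W *v X n \<omega>"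
      by (simp only: W_def N_def S11 S21 B_def X_def partial_out_vec_cols[OF \<Sigma>] kron_row_vec_cols)
    finally have RW: "J *v (W *v vec_cols ?R) = g n + J *v (W *v X n \<omega>)"
      by (simp only: g_alt matrix_vector_right_distrib)
    have RB: "J *v (?R *v b_vec \<beta>0) = \<Delta> *\<^sub>R h n + J *v (B *v X n \<omega>)"
      by (simp add: Rb h_def matrix_vector_right_distrib matrix_vector_mult_scaleR)
    \<comment> \<open>\<open>hg\<close> and \<open>hh\<close> match the numerator of the centering
      constant, \<open>norm_g\<close> its denominator.\<close>
    show ?thesis
      unfolding LM1_eq[OF \<Sigma>] F_def S11[symmetric] J_def[symmetric] W_def[symmetric] RW RB norm_g[OF n] hg[OF n] hh ..
  qed

  \<comment> \<open>Limits of the rescaled signal vectors\<close>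
  have cross_pd: "pos_def ((1 / real n) *\<^sub>R cross n (Z n) (Z n))" if "n \<ge> CARD('k)" for n
  proof -
    have "n > 0" using that zero_less_card_finite[where 'a='k] by linarith
    then show ?thesis
      using pos_def_cross[OF rank[OF that]]
      by (simp add: pos_def_def transpose_scalar flip: scaleR_matrix_vector_assoc)
  qed
  have "(\<lambda>n. msqrt ((1 / real n) *\<^sub>R cross n (Z n) (Z n)) *v \<pi>) \<longlonglongrightarrow> msqrt D *v \<pi>"
    using cross_pd by (intro tendsto_matrix_vector_mult tendsto_msqrt Dlim D eventually_sequentiallyI)
  \<comment> \<open>The root is homogeneous of degree 1/2, so the factor \<open>1 / n\<close> comes
    out as \<open>S n\<close>.\<close>
  moreover have "\<forall>\<^sub>F n in sequentially. msqrt ((1 / real n) *\<^sub>R cross n (Z n) (Z n)) *v \<pi> = S n *\<^sub>R \<mu> n"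
  proof (rule eventually_sequentiallyI[of "CARD('k)"])
    fix n assume n: "CARD('k) \<le> n"
    then have "n > 0" using zero_less_card_finite[where 'a='k] by linarith
    then show "msqrt ((1 / real n) *\<^sub>R cross n (Z n) (Z n)) *v \<pi> = S n *\<^sub>R \<mu> n"
      by (simp add: msqrt_scaleR pos_def_cross[OF rank[OF n]] S_def \<mu> real_sqrt_divide flip: scaleR_matrix_vector_assoc)
  qed
  ultimately have S\<mu>: "(\<lambda>n. S n *\<^sub>R \<mu> n) \<longlonglongrightarrow> msqrt D *v \<pi>"
    by (rule Lim_transform_eventually)
  have mv: "(\<lambda>n. A *v (S n *\<^sub>R \<mu> n)) \<longlonglongrightarrow> A *v (msqrt D *v \<pi>)" for A :: "real^'k^'k"
    using bounded_linear.tendsto[OF matrix_vector_mul_bounded_linear S\<mu>] .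
  have Sh: "(\<lambda>n. S n *\<^sub>R h n) \<longlonglongrightarrow> h0"
    using mv[of J] by (simp add: h_def h0_def matrix_vector_mult_scaleR)
  have \<gamma>: "\<gamma> = J *v ((mat 1 - \<Delta> *\<^sub>R N) *v (msqrt D *v \<pi>))"
    by (simp only: \<gamma>_def J_def N_def matrix_vector_mul_assoc matrix_mul_assoc)
  have "(\<lambda>n. (J ** (mat 1 - \<Delta> *\<^sub>R N)) *v (S n *\<^sub>R \<mu> n)) \<longlonglongrightarrow> \<gamma>"
    using mv[of "J ** (mat 1 - \<Delta> *\<^sub>R N)"] by (simp only: \<gamma> matrix_vector_mul_assoc matrix_mul_assoc)
  then have Sg: "(\<lambda>n. S n *\<^sub>R g n) \<longlonglongrightarrow> \<gamma>"
    by (simp add: g_alt matrix_vector_mult_scaleR matrix_vector_mult_diff_rdistrib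
      flip: matrix_vector_mul_assoc scaleR_matrix_vector_assoc)
  have S0: "S \<longlonglongrightarrow> 0" unfolding S_def
    by (intro real_tendsto_divide_at_top[OF tendsto_const] filterlim_compose[OF sqrt_at_top] filterlim_real_sequentially)
  have "h0 \<noteq> 0"
  proof
    assume "h0 = 0"
    then have "msqrt \<Sigma>11 *v h0 = 0" by simp
    then have "msqrt D *v \<pi> = 0"
      unfolding h0_def matrix_vector_mul_assoc[of "msqrt \<Sigma>11"] J(3) by simp
    then have "inv_msqrt D *v (msqrt D *v \<pi>) = 0" by simp
    then show False using \<open>\<pi> \<noteq> 0\<close> by (simp add: matrix_vector_mul_assoc inv_msqrt_pos_def[OF D])
  qed
  \<comment> \<open>The design condition is given along the sequence. Passing
    \<open>h' g = h' h\<close> to the limit yields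
    \<open>h0 \<bullet> \<gamma> = h0 \<bullet> h0 > 0\<close>, which excludes
    \<open>\<gamma> = 0\<close>.\<close>
  have "(\<lambda>n. (S n *\<^sub>R h n) \<bullet> (S n *\<^sub>R g n)) \<longlonglongrightarrow> h0 \<bullet> \<gamma>"
    by (intro tendsto_inner Sh Sg)
  moreover have "\<forall>\<^sub>F n in sequentially. (S n *\<^sub>R h n) \<bullet> (S n *\<^sub>R g n) = (S n *\<^sub>R h n) \<bullet> (S n *\<^sub>R h n)"
    by (rule eventually_sequentiallyI[of "CARD('k)"]) (simp add: hg)
  ultimately have "(\<lambda>n. (S n *\<^sub>R h n) \<bullet> (S n *\<^sub>R h n)) \<longlonglongrightarrow> h0 \<bullet> \<gamma>"
    by (rule Lim_transform_eventually)
  moreover have "(\<lambda>n. (S n *\<^sub>R h n) \<bullet> (S n *\<^sub>R h n)) \<longlonglongrightarrow> h0 \<bullet> h0"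
    by (intro tendsto_inner Sh)
  ultimately have "h0 \<bullet> \<gamma> = h0 \<bullet> h0" by (rule LIMSEQ_unique)
  with \<open>h0 \<noteq> 0\<close> have \<gamma>0: "\<gamma> \<noteq> 0" by auto

  \<comment> \<open>The limiting linear form\<close>
  define m where "m = h0 - ((h0 \<bullet> \<gamma>) / (norm \<gamma>)\<^sup>2) *\<^sub>R \<gamma>"
  define p where "p = (1 / norm \<gamma>) *\<^sub>R (J *v \<gamma>)"
  define q where "q = (\<Delta> / norm \<gamma>) *\<^sub>R (J *v m)"
  \<comment> \<open>\<open>m\<close> is \<open>h0\<close> projected off \<open>\<gamma>\<close>, as
    the derivative of normalization at \<open>\<gamma>\<close> requires; transposing
    \<open>B\<close> and \<open>W\<close> collects the limit into one coefficient vector on the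
    errors.\<close>
  define c where "c = transpose B *v p + transpose W *v q"
  have c_inner: "c \<bullet> x = p \<bullet> (B *v x) + q \<bullet> (W *v x)" for x
    unfolding c_def inner_add_left by (simp only: inner_matrix_transpose)
  have lim: "((\<lambda>(n, y). F n y) \<longlongrightarrow> c \<bullet> x) (sequentially \<times>\<^sub>F nhds x)" for x
  proof -
    let ?P = "sequentially \<times>\<^sub>F nhds x"
    have fst: "filterlim fst sequentially ?P" and snd: "filterlim snd (nhds x) ?P"
      by (simp_all add: filterlim_def filtermap_fst_prod_filter filtermap_snd_prod_filter)
    have lin: "((\<lambda>z. J *v (A *v snd z)) \<longlongrightarrow> J *v (A *v x)) ?P" for A :: "real^(2 \<times> 'k)^'k"
      by (intro bounded_linear.tendsto[OF matrix_vector_mul_bounded_linear] snd)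
    have ev: "\<forall>\<^sub>F z in ?P. S (fst z) > 0"
      using fst by (rule eventually_compose_filterlim[rotated])
        (auto simp: S_def intro!: eventually_sequentiallyI[of 1])
    have "((\<lambda>z. F (fst z) (snd z)) \<longlongrightarrow>
      ((J *v (B *v x)) \<bullet> \<gamma>) / norm \<gamma>
        + \<Delta> / norm \<gamma> * (h0 \<bullet> (J *v (W *v x)) - (h0 \<bullet> \<gamma>) * (\<gamma> \<bullet> (J *v (W *v x))) / (norm \<gamma>)\<^sup>2)) ?P"
      unfolding F_def
      by (rule tendsto_normalized_inner_diff[where S="\<lambda>z. S (fst z)"])
        (intro \<gamma>0 ev lin filterlim_compose[OF S0 fst] filterlim_compose[OF Sh fst] filterlim_compose[OF Sg fst])+
    also have "((J *v (B *v x)) \<bullet> \<gamma>) / norm \<gamma>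
        + \<Delta> / norm \<gamma> * (h0 \<bullet> (J *v (W *v x)) - (h0 \<bullet> \<gamma>) * (\<gamma> \<bullet> (J *v (W *v x))) / (norm \<gamma>)\<^sup>2)
       = c \<bullet> x"
      by (simp add: c_inner p_def q_def m_def Jt[symmetric] inner_diff_left inner_commute[of _ \<gamma>])
    finally show ?thesis by (simp add: case_prod_unfold)
  qed

  \<comment> \<open>Variance of the limiting form\<close>
  define v where "v = 1 + \<Delta>\<^sup>2 / (norm \<gamma>)\<^sup>2 *
          (\<pi> \<bullet> ((msqrt D ** inv_msqrt \<Sigma>11 ** M\<gamma> ** inv_msqrt \<Sigma>11 ** matrix_inv \<Sigma>sup22
                ** inv_msqrt \<Sigma>11 ** M\<gamma> ** inv_msqrt \<Sigma>11 ** msqrt D) *v \<pi>))"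
  have M\<gamma>_mult: "M\<gamma> *v x = x - ((x \<bullet> \<gamma>) / (norm \<gamma>)\<^sup>2) *\<^sub>R \<gamma>" for x
  proof -
    have "((columnvector \<gamma> :: real^1^'k) ** (rowvector \<gamma> :: real^'k^1)) *v x = (x \<bullet> \<gamma>) *\<^sub>R \<gamma>"
      by (simp add: matrix_vector_mult_def matrix_matrix_mult_def columnvector_def rowvector_def vec_eq_iff
          inner_vec_def sum_distrib_left sum_distrib_right mult_ac)
    then show ?thesis
      by (simp add: M\<gamma> matrix_vector_mult_diff_rdistrib flip: scaleR_matrix_vector_assoc)
  qed
  have M\<gamma>t: "x \<bullet> (M\<gamma> *v y) = (M\<gamma> *v x) \<bullet> y" for x y
    by (simp add: M\<gamma>_mult inner_diff_left inner_diff_right inner_commute)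
  have Dt: "x \<bullet> (msqrt D *v y) = (msqrt D *v x) \<bullet> y" for x y
    by (simp only: inner_matrix_transpose pos_def_symmetric[OF msqrt_pos_def(1)[OF D]])
  have "M\<gamma> *v h0 = m" by (simp add: M\<gamma>_mult m_def)
  \<comment> \<open>The long product is the quadratic form of \<open>C\<close> at
    \<open>J m\<close>, since the outer factors are symmetric and can be moved to the left
    argument.\<close>
  then have v_eq: "v = 1 + \<Delta>\<^sup>2 / (norm \<gamma>)\<^sup>2 * ((J *v m) \<bullet> (C *v (J *v m)))"
    unfolding v_def J_def[symmetric] C_def[symmetric]
    by (simp only: matrix_vector_mul_assoc[symmetric] h0_def[symmetric] Dt Jt M\<gamma>t)
  \<comment> \<open>The cross terms vanish because the residual map \<open>W\<close> is uncorrelated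
    with \<open>B\<close>.\<close>
  have cov: "c \<bullet> (\<Sigma> *v c) = p \<bullet> (\<Sigma>11 *v p) + q \<bullet> (C *v q)"
  proof -
    have BB: "B *v (\<Sigma> *v (transpose B *v x)) = \<Sigma>11 *v x" for x
      by (simp only: matrix_vector_mul_assoc matrix_mul_assoc S11 Sigma_block_eq_kron_row column_B_mat B_def)
    have WB0: "W ** \<Sigma> ** transpose B = 0"
      unfolding W_def B_def by (rule partial_out_uncorrelated[OF \<Sigma>])
    have WB: "W *v (\<Sigma> *v (transpose B *v x)) = 0" for x
      by (simp only: matrix_vector_mul_assoc matrix_mul_assoc WB0 matrix_vector_mult_0)
    have "transpose (W ** \<Sigma> ** transpose B) = B ** \<Sigma> ** transpose W"
      by (simp add: matrix_transpose_mul pos_def_symmetric[OF \<Sigma>] matrix_mul_assoc)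
    then have "B ** \<Sigma> ** transpose W = 0"
      unfolding WB0 by (simp add: vec_eq_iff transpose_def)
    then have BW: "B *v (\<Sigma> *v (transpose W *v x)) = 0" for x
      by (simp only: matrix_vector_mul_assoc matrix_mul_assoc matrix_vector_mult_0)
    have WW: "W *v (\<Sigma> *v (transpose W *v x)) = C *v x" for x
      by (simp only: matrix_vector_mul_assoc matrix_mul_assoc W_def C_def Ssup partial_out_covariance[OF \<Sigma>])
    show ?thesis
      unfolding c_inner unfolding c_def
      by (simp only: matrix_vector_right_distrib BB BW WB WW add_0_left add_0_right)
  qed
  have "J *v (\<Sigma>11 *v (J *v \<gamma>)) = \<gamma>"
    by (simp only: matrix_vector_mul_assoc matrix_mul_assoc J(3,4) matrix_vector_mul_lid)
  then have "(J *v \<gamma>) \<bullet> (\<Sigma>11 *v (J *v \<gamma>)) = (norm \<gamma>)\<^sup>2"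
    by (simp add: Jt[symmetric] power2_norm_eq_inner)
  then have "p \<bullet> (\<Sigma>11 *v p) = 1"
    using \<gamma>0 by (simp add: p_def matrix_vector_mult_scaleR power2_eq_square)
  then have cv: "c \<bullet> (\<Sigma> *v c) = v"
    unfolding cov v_eq by (simp add: q_def matrix_vector_mult_scaleR power2_eq_square)
  have C_pd: "pos_def C"
    unfolding C_def Ssup by (intro pos_def_matrix_inv pos_def_Sigma_sup22 \<Sigma>)
  then have "q \<bullet> (C *v q) \<ge> 0"
    using pos_def_imp_pos_semidef by (auto simp: pos_semidef_def)
  \<comment> \<open>The \<open>S_stat\<close> part alone contributes variance 1, so the limit law is
    nondegenerate, as \<open>distr_mvn_inner\<close> demands.\<close>
  then have c_pos: "c \<bullet> (\<Sigma> *v c) > 0"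
    unfolding cov \<open>p \<bullet> (\<Sigma>11 *v p) = 1\<close> by simp

  \<comment> \<open>Weak convergence of the centered statistic\<close>
  have Fm: "F n \<in> borel_measurable borel" for n
  proof -
    have [measurable]: "(\<lambda>x. J *v (A *v x)) \<in> borel_measurable borel" for A :: "real^(2 \<times> 'k)^'k"
      unfolding matrix_vector_mul_assoc
      by (intro borel_measurable_continuous_onI matrix_vector_mult_linear_continuous_on)
    show ?thesis unfolding F_def by measurable
  qed
  have "weak_conv_m (\<lambda>n. distr (M n) borel (\<lambda>\<omega>. F n (X n \<omega>))) (distr (mvn \<Sigma>) borel (\<lambda>x. c \<bullet> x))"
    by (rule weak_conv_m_extended_mapping[OF conv mvn_prob mvn_sets prob Xm lim _ Fm])
      (auto intro!: continuous_intros)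
  also have "distr (mvn \<Sigma>) borel (\<lambda>x. c \<bullet> x) = density lborel (normal_density 0 (sqrt v))"
    unfolding distr_mvn_inner[OF \<Sigma> mvn_prob c_pos] cv ..
  also have "weak_conv_m (\<lambda>n. distr (M n) borel (\<lambda>\<omega>. F n (X n \<omega>))) (density lborel (normal_density 0 (sqrt v)))
    \<longleftrightarrow> ?thesis"
    unfolding v_def by (intro weak_conv_m_cong[of "CARD('k)"] distr_cong refl) (simp add: LM1_F)
  finally show ?thesis .
qed

end
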